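(* Let $m\ge1$, $1\le r\le 2m-1$ and $I\subseteq M_r$. Then the minimum Hamming distance of $\mathcal C(r,I,2m)$ satisfies: $\mathrm{dist}(\mathcal C(r,I,2m))=2^{2m-r+1}$ if $\{m,m-1,m-2\}\cap I=\emptyset$; $\mathrm{dist}(\mathcal C(r,I,2m))\ge 2^{2m-r}$ if $\{m,m-1\}\cap I\ne\emptyset$; $\mathrm{dist}(\mathcal C(r,I,2m))\ge 3\cdot2^{2m-r-1}$ if $\{m,m-2\}\cap I=\{m-2\}$.
   Context: Let $n=4^m-1$ and let $\zeta\in\overline{\mathbb F}_2$ be a primitive $n$-th root of unity. For $0\le u\le n$ write $u=\sum_{i=0}^{2m-1}u_i2^i$ with $u_i\in\{0,1\}$; $\mathrm{wt}_2(u)=\sum u_i$, $O(u)=\#\{0\le i\le m-1:u_{2i+1}=1\}$, $E(u)=\#\{0\le i\le m-1:u_{2i}=1\}$. $M_r=\{0\le k\le m:m-k\text{ even}\}$ if $r$ is even and $M_r=\{0\le k\le m:m-k\text{ odd}\}$ if $r$ is odd. $\Theta^{(r)}_k=\{\zeta^u:0\le u\le n,\ \mathrm{wt}_2(u)=2m-r,\ |O(u)-E(u)|=m-k\}$, and $Z_{r-1}=\{\zeta^u:0<u\le n,\ \mathrm{wt}_2(u)\le 2m-r\}$. A binary cyclic code of length $n$ with zero set $Z$ is $\{(c_0,\dots,c_{n-1})\in\mathbb F_2^n:\sum_ic_iz^i=0\ \forall z\in Z\}$; its extended code is $\{(c_0,\dots,c_{n-1},\sum c_i)\}\subseteq\mathbb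 F_2^{n+1}$. For $0\le r<2m$ and $I\subseteq M_r$, $\mathcal C(r,I,2m)$ is the extended code of the cyclic code with zero set $Z_{r-1}\setminus\bigcup_{k\in I}\Theta^{(r)}_k$. *)

theory Defs
  imports
    "HOL-Library.Z2"
    "HOL-Algebra.Algebraic_Closure_Type"
    "Jordan_Normal_Form.Matrix"
begin

(* The field F_2 is the type bit of HOL-Library.Z2 and its algebraic closure is bit alg_closure;
   F_2^n is carrier_vec n. In terms, "bit u i" is the library's predicate for the i-th binary
   digit of u being 1. *)

definition primitive_root_of_unity :: "nat \<Rightarrow> 'a::monoid_mult \<Rightarrow> bool" where
  "primitive_root_of_unity n z \<longleftrightarrow> n > 0 \<and> z ^ n = 1 \<and> (\<forall>k. 0 < k \<and> k < n \<longrightarrow> z ^ k \<noteq> 1)"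

definition hamming_dist :: "'a vec \<Rightarrow> 'a vec \<Rightarrow> nat" where
  "hamming_dist x y = card {i. i < dim_vec x \<and> x $ i \<noteq> y $ i}"

(* Only meaningful for codes with at least two codewords: Inf {} = 0 on nat. *)
definition min_dist :: "'a vec set \<Rightarrow> nat" where
  "min_dist C = Inf {hamming_dist x y | x y. x \<in> C \<and> y \<in> C \<and> x \<noteq> y}"

definition cyclic_code :: "nat \<Rightarrow> bit alg_closure set \<Rightarrow> bit vec set" where
  "cyclic_code n Z = {c \<in> carrier_vec n. \<forall>z\<in>Z. (\<Sum>i<n. to_ac (c $ i) * z ^ i) = 0}"

definition extend_vec :: "bit vec \<Rightarrow> bit vec" where
  "extend_vec c =
     vec (dim_vec c + 1) (\<lambda>i. if i < dim_vec c then c $ i else (\<Sum>j<dim_vec c. c $ j))"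

definition extended_code :: "bit vec set \<Rightarrow> bit vec set" where
  "extended_code C = extend_vec ` C"

definition code_length :: "nat \<Rightarrow> nat" where
  "code_length m = 4 ^ m - 1"

definition wt2 :: "nat \<Rightarrow> nat \<Rightarrow> nat" where
  "wt2 m u = (\<Sum>i<2*m. of_bool (bit u i))"

definition odd_wt :: "nat \<Rightarrow> nat \<Rightarrow> nat" where
  "odd_wt m u = card {i. i < m \<and> bit u (2*i + 1)}"

definition even_wt :: "nat \<Rightarrow> nat \<Rightarrow> nat" where
  "even_wt m u = card {i. i < m \<and> bit u (2*i)}"

(* The indices k are integers so that m - k, and later m - 1 and m - 2, are not truncated. *)
definition M_set :: "nat \<Rightarrow> nat \<Rightarrow> int set" where
  "M_set m r =
     (if even r then {k. 0 \<le> k \<and> k \<le> int m \<and> even (int m - k)}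
      else {k. 0 \<le> k \<and> k \<le> int m \<and> odd (int m - k)})"

definition Theta :: "nat \<Rightarrow> 'a::monoid_mult \<Rightarrow> nat \<Rightarrow> int \<Rightarrow> 'a set" where
  "Theta m \<zeta> r k = {\<zeta> ^ u | u. u \<le> code_length m \<and> int (wt2 m u) = 2 * int m - int r \<and>
     \<bar>int (odd_wt m u) - int (even_wt m u)\<bar> = int m - k}"

(* The set usually written Z_{r-1}. It is indexed by r here, so that r = 0 needs no index -1. *)
definition Z_pred :: "nat \<Rightarrow> 'a::monoid_mult \<Rightarrow> nat \<Rightarrow> 'a set" where
  "Z_pred m \<zeta> r =
     {\<zeta> ^ u | u. 0 < u \<and> u \<le> code_length m \<and> int (wt2 m u) \<le> 2 * int m - int r}"

(* C(r, I, 2m), for 0 \<le> r < 2m and I \<subseteq> M_r, with \<zeta> a primitive root of unity of order 4^m - 1. *)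
definition C_code :: "nat \<Rightarrow> bit alg_closure \<Rightarrow> nat \<Rightarrow> int set \<Rightarrow> bit vec set" where
  "C_code m \<zeta> r I =
     extended_code (cyclic_code (code_length m) (Z_pred m \<zeta> r - (\<Union>k\<in>I. Theta m \<zeta> r k)))"

end

theory Submission
  imports Defs
begin

text \<open>
  By Fourier inversion a codeword is a function \<open>f\<close> on the field of \<open>4\<^sup>m\<close> elements, written as a
  combination of powers \<open>x\<^sup>e\<close>. After choosing a basis over the field of four elements, \<open>x\<^sup>e\<close> becomes a
  polynomial in the coordinates and their conjugates, whose part of top degree \<open>wt\<^sub>2(e)\<close> has bidegree
  \<open>(E(e), O(e))\<close>. So the code consists of functions of degree at most \<open>r\<close> whose components of degree
  \<open>r\<close> have bidegrees \<open>(a, b)\<close> with \<open>\<bar>a - b\<bar> \<ge> s\<close>, where \<open>s\<close> is 3, 0 and 2 in the three cases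
  of the theorem.

  The weight of a non-zero such function is at least \<open>4\<^sup>m / 2\<^sup>r\<close>, times \<open>3/2\<close> if \<open>s = 2\<close> and times 2 if
  \<open>s \<ge> 3\<close>. This is an induction on \<open>m\<close>: restrict the function to the four hyperplanes on which the
  first coordinate is constant. If 4, 3, 2 or 1 of the restrictions do not vanish, they are again of
  this kind, with the parameters \<open>(r, s)\<close>, \<open>(r - 1, s - 1)\<close>, \<open>(r - 1, s)\<close> or \<open>(r - 2, s)\<close>.

  The value \<open>2\<^bsup>2m-r+1\<^esup>\<close> is attained by the indicator function of a subspace over the
  prime field, on which all power sums with exponents of small binary weight vanish.
\<close>

section \<open>Weights of functions with restricted bidegrees\<close>

locale gf4 =
  fixes \<omega> :: "'a::field"
  assumes two_eq_0: "(2::'a) = 0"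
    and omega_sq: "\<omega>\<^sup>2 = \<omega> + 1"
begin

definition F4 :: "'a set" where
  "F4 = {0, 1, \<omega>, \<omega> + 1}"

definition words :: "nat \<Rightarrow> 'a list set" where
  "words m = {w. set w \<subseteq> F4 \<and> length w = m}"

text \<open>
  \<open>bideg m W f\<close>: on \<open>F4\<^sup>m\<close>, \<open>f\<close> is a combination of monomials that contain \<open>a\<close> of the coordinates
  and \<open>b\<close> of their conjugates \<open>z\<^sup>2\<close>, with \<open>W a b\<close>. A coordinate and its conjugate may both occur, whence
  the factor \<open>z ^ 3\<close>; every function on \<open>F4\<close> is uniquely of the form
  \<open>a + b * z + c * z\<^sup>2 + d * z ^ 3\<close>.
\<close>

primrec bideg :: "nat \<Rightarrow> (nat \<Rightarrow> nat \<Rightarrow> bool) \<Rightarrow> ('a list \<Rightarrow> 'a) \<Rightarrow> bool" where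
  "bideg 0 W f \<longleftrightarrow> W 0 0 \<or> f [] = 0"
| "bideg (Suc m) W f \<longleftrightarrow> (\<exists>f0 g1 g2 h.
     bideg m W f0 \<and> bideg m (\<lambda>a b. W (Suc a) b) g1 \<and> bideg m (\<lambda>a b. W a (Suc b)) g2 \<and>
     bideg m (\<lambda>a b. W (Suc a) (Suc b)) h \<and>
     (\<forall>z\<in>F4. \<forall>w\<in>words m. f (z # w) = f0 w + z * g1 w + z\<^sup>2 * g2 w + z ^ 3 * h w))"

definition wt :: "nat \<Rightarrow> ('a list \<Rightarrow> 'a) \<Rightarrow> nat" where
  "wt m f = card {w \<in> words m. f w \<noteq> 0}"

section \<open>Arithmetic in characteristic two and in the field of four elements\<close>

lemma add_self [simp]: "x + x = (0::'a)"
  using two_eq_0 mult_2[of x] by simp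

lemma uminus_eq [simp]: "- x = (x::'a)"
  by (rule minus_unique) simp

lemma minus_eq_add [simp]: "x - y = x + (y::'a)"
  unfolding diff_conv_add_uminus by simp

lemma eq_iff_add_eq_0: "x = y \<longleftrightarrow> x + y = (0::'a)"
  using eq_iff_diff_eq_0[of x y] by simp

lemma add_self_left [simp]: "x + (x + y) = (y::'a)"
  by (simp flip: add.assoc)

lemma omega_mult: "\<omega> * \<omega> = \<omega> + 1" "\<omega> * (\<omega> * x) = (\<omega> + 1) * x"
  using omega_sq by (simp_all add: power2_eq_square flip: mult.assoc)

lemma omega_neq: "\<omega> \<noteq> 0" "\<omega> \<noteq> 1" "\<omega> + 1 \<noteq> 0"
proof -
  show "\<omega> \<noteq> 0" using omega_sq by auto
  then show "\<omega> + 1 \<noteq> 0" using omega_sq by auto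
  then show "\<omega> \<noteq> 1" by auto
qed

lemma F4_distinct: "distinct [0, 1, \<omega>, \<omega> + 1]"
  using omega_neq omega_neq[symmetric] by simp

lemma card_F4: "card F4 = 4" and finite_F4: "finite F4"
  using F4_distinct distinct_card[of "[0, 1, \<omega>, \<omega> + 1]"] by (auto simp: F4_def)

lemma sum_F4: "(\<Sum>z\<in>F4. f z) = f 0 + (f 1 + (f \<omega> + f (\<omega> + 1)))"
  for f :: "'a \<Rightarrow> 'b::comm_monoid_add"
  using F4_distinct by (simp add: F4_def)

lemmas F4_arith = algebra_simps omega_mult power2_eq_square power3_eq_cube eval_nat_numeral

lemma F4_pow4: "z \<in> F4 \<Longrightarrow> z ^ 4 = z"
  by (auto simp: F4_def F4_arith)

lemma F4_closed: "x \<in> F4 \<Longrightarrow> y \<in> F4 \<Longrightarrow> x + y \<in> F4" "x \<in> F4 \<Longrightarrow> y \<in> F4 \<Longrightarrow> x * y \<in> F4"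
  by (auto simp: F4_def F4_arith)

lemma F4_inverse:
  assumes "x \<in> F4"
  shows "inverse x \<in> F4"
proof -
  have "inverse \<omega> = \<omega> + 1" "inverse (\<omega> + 1) = \<omega>"
    by (rule inverse_unique; simp add: F4_arith)+
  then show ?thesis
    using assms by (auto simp: F4_def)
qed

section \<open>Words over \<open>F4\<close>: counting and weights\<close>

lemma Cons_in_words [simp]: "z # w \<in> words (Suc m) \<longleftrightarrow> z \<in> F4 \<and> w \<in> words m"
  by (auto simp: words_def)

lemma words_0 [simp]: "words 0 = {[]}"
  by (auto simp: words_def)

lemma words_Suc: "words (Suc m) = (\<Union>z\<in>F4. (#) z ` words m)"
  by (auto simp: words_def length_Suc_conv)

lemma finite_words: "finite (words m)"
  and card_words: "card (words m) = 4 ^ m"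
  unfolding words_def using finite_F4 card_F4
  by (simp_all add: finite_lists_length_eq card_lists_length_eq)

lemma wt_Suc: "wt (Suc m) f = (\<Sum>z\<in>F4. wt m (\<lambda>w. f (z # w)))"
proof -
  have "{w \<in> words (Suc m). f w \<noteq> 0} = (\<Union>z\<in>F4. (#) z ` {w \<in> words m. f (z # w) \<noteq> 0})"
    by (auto simp: words_Suc)
  also have "card \<dots> = (\<Sum>z\<in>F4. card ((#) z ` {w \<in> words m. f (z # w) \<noteq> 0}))"
    using finite_F4 finite_words by (intro card_UN_disjoint) auto
  also have "\<dots> = (\<Sum>z\<in>F4. wt m (\<lambda>w. f (z # w)))"
    unfolding wt_def by (intro sum.cong refl card_image) auto
  finally show ?thesis
    by (simp add: wt_def)
qed

section \<open>Closure properties of \<open>bideg\<close> and uniqueness of the expansion\<close>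

lemma bideg_SucI:
  assumes "bideg m W f0" "bideg m (\<lambda>a b. W (Suc a) b) g1" "bideg m (\<lambda>a b. W a (Suc b)) g2"
    "bideg m (\<lambda>a b. W (Suc a) (Suc b)) h"
    "\<And>z w. z \<in> F4 \<Longrightarrow> w \<in> words m \<Longrightarrow> f (z # w) = f0 w + z * g1 w + z\<^sup>2 * g2 w + z ^ 3 * h w"
  shows "bideg (Suc m) W f"
  unfolding bideg.simps by (intro exI conjI ballI) (fact assms)+

lemma bideg_SucE:
  assumes "bideg (Suc m) W f"
  obtains f0 g1 g2 h where
    "bideg m W f0" "bideg m (\<lambda>a b. W (Suc a) b) g1" "bideg m (\<lambda>a b. W a (Suc b)) g2"
    "bideg m (\<lambda>a b. W (Suc a) (Suc b)) h"
    "\<And>z w. z \<in> F4 \<Longrightarrow> w \<in> words m \<Longrightarrow> f (z # w) = f0 w + z * g1 w + z\<^sup>2 * g2 w + z ^ 3 * h w"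
  using assms that unfolding bideg.simps by metis

lemma bideg_cong:
  assumes "\<And>w. w \<in> words m \<Longrightarrow> f w = g w" "bideg m W f"
  shows "bideg m W g"
proof (cases m)
  case (Suc k)
  then have "\<forall>z\<in>F4. \<forall>w\<in>words k. g (z # w) = f (z # w)"
    using assms(1) by simp
  with assms(2) Suc show ?thesis
    by (simp cong: ball_cong)
qed (use assms in simp)

lemma bideg_mono:
  assumes "bideg m W f" "\<And>a b. W a b \<Longrightarrow> V a b"
  shows "bideg m V f"
  using assms
proof (induction m arbitrary: W V f)
  case (Suc m)
  from Suc.prems(1) obtain f0 g1 g2 h where *: "bideg m W f0" "bideg m (\<lambda>a b. W (Suc a) b) g1"
    "bideg m (\<lambda>a b. W a (Suc b)) g2" "bideg m (\<lambda>a b. W (Suc a) (Suc b)) h"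
    "\<And>z w. z \<in> F4 \<Longrightarrow> w \<in> words m \<Longrightarrow> f (z # w) = f0 w + z * g1 w + z\<^sup>2 * g2 w + z ^ 3 * h w"
    by (rule bideg_SucE) (rule that)
  show ?case
    by (rule bideg_SucI[OF Suc.IH[OF *(1)] Suc.IH[OF *(2)] Suc.IH[OF *(3)] Suc.IH[OF *(4)] *(5)])
       (simp_all add: Suc.prems(2))
qed auto

lemma bideg_lincomb:
  assumes "bideg m W f" "bideg m W g"
  shows "bideg m W (\<lambda>w. c * f w + d * g w)"
  using assms
proof (induction m arbitrary: W f g)
  case (Suc m)
  from Suc.prems(1) obtain f0 f1 f2 f3 where F: "bideg m W f0" "bideg m (\<lambda>a b. W (Suc a) b) f1"
    "bideg m (\<lambda>a b. W a (Suc b)) f2" "bideg m (\<lambda>a b. W (Suc a) (Suc b)) f3"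
    "\<And>z w. z\<in>F4 \<Longrightarrow> w\<in>words m \<Longrightarrow> f (z # w) = f0 w + z * f1 w + z\<^sup>2 * f2 w + z ^ 3 * f3 w"
    by (rule bideg_SucE) (rule that)
  from Suc.prems(2) obtain g0 g1 g2 g3 where G: "bideg m W g0" "bideg m (\<lambda>a b. W (Suc a) b) g1"
    "bideg m (\<lambda>a b. W a (Suc b)) g2" "bideg m (\<lambda>a b. W (Suc a) (Suc b)) g3"
    "\<And>z w. z\<in>F4 \<Longrightarrow> w\<in>words m \<Longrightarrow> g (z # w) = g0 w + z * g1 w + z\<^sup>2 * g2 w + z ^ 3 * g3 w"
    by (rule bideg_SucE) (rule that)
  show ?case
    by (rule bideg_SucI[OF Suc.IH[OF F(1) G(1)] Suc.IH[OF F(2) G(2)] Suc.IH[OF F(3) G(3)]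
          Suc.IH[OF F(4) G(4)]]) (simp add: F(5) G(5) algebra_simps)
qed auto

lemma bideg_add: "bideg m W f \<Longrightarrow> bideg m W g \<Longrightarrow> bideg m W (\<lambda>w. f w + g w)"
  using bideg_lincomb[of m W f g 1 1] by simp

lemma bideg_cmult: "bideg m W f \<Longrightarrow> bideg m W (\<lambda>w. c * f w)"
  using bideg_lincomb[of m W f f c 0] by simp

lemma bideg_zero: "bideg m W (\<lambda>w. 0)"
proof (induction m arbitrary: W)
  case (Suc m)
  show ?case
    by (rule bideg_SucI[OF Suc Suc Suc Suc]) simp
qed auto

lemma bideg_sum: "(\<And>i. i \<in> S \<Longrightarrow> bideg m W (f i)) \<Longrightarrow> bideg m W (\<lambda>w. \<Sum>i\<in>S. f i w)"
  by (induction S rule: infinite_finite_induct) (auto simp: bideg_zero intro: bideg_add)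

lemma bideg_one: "W 0 0 \<Longrightarrow> bideg m W (\<lambda>w. 1)"
proof (induction m arbitrary: W)
  case (Suc m)
  show ?case
    by (rule bideg_SucI[of m W "\<lambda>_. 1" "\<lambda>_. 0" "\<lambda>_. 0" "\<lambda>_. 0"])
       (simp_all add: Suc bideg_zero)
qed auto

lemma bideg_empty: "bideg m (\<lambda>a b. False) f \<Longrightarrow> w \<in> words m \<Longrightarrow> f w = 0"
proof (induction m arbitrary: f w)
  case (Suc m)
  then obtain z v where zv: "w = z # v" "z \<in> F4" "v \<in> words m"
    by (auto simp: words_Suc)
  from Suc.prems(1) obtain f0 g1 g2 h where *: "bideg m (\<lambda>a b. False) f0"
    "bideg m (\<lambda>a b. False) g1" "bideg m (\<lambda>a b. False) g2" "bideg m (\<lambda>a b. False) h"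
    "\<And>z w. z \<in> F4 \<Longrightarrow> w \<in> words m \<Longrightarrow> f (z # w) = f0 w + z * g1 w + z\<^sup>2 * g2 w + z ^ 3 * h w"
    by (rule bideg_SucE) (rule that)
  have "f0 v = 0 \<and> g1 v = 0 \<and> g2 v = 0 \<and> h v = 0"
    using Suc.IH[OF _ zv(3)] *(1-4) by blast
  with *(5) zv show ?case
    by simp
qed auto

text \<open>Interpolation: the sum of \<open>z ^ k\<close> over \<open>F4\<close> is 1 if
  \<open>k\<close> is a positive multiple of 3, and 0 otherwise.\<close>

lemma coeff_eqs:
  assumes "\<And>z. z \<in> F4 \<Longrightarrow> p z = a + z * b + z\<^sup>2 * c + z ^ 3 * d"
  shows "p 0 = a" "(\<Sum>z\<in>F4. z\<^sup>2 * p z) = b" "(\<Sum>z\<in>F4. z * p z) = c" "(\<Sum>z\<in>F4. p z) = d"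
proof -
  have p: "p 0 = a" "p 1 = a + b + c + d" "p \<omega> = a + \<omega> * b + \<omega>\<^sup>2 * c + \<omega> ^ 3 * d"
    "p (\<omega> + 1) = a + (\<omega> + 1) * b + (\<omega> + 1)\<^sup>2 * c + (\<omega> + 1) ^ 3 * d"
    using assms[of 0] assms[of 1] assms[of \<omega>] assms[of "\<omega> + 1"] by (auto simp: F4_def)
  show "p 0 = a" by (rule p)
  show "(\<Sum>z\<in>F4. z\<^sup>2 * p z) = b" "(\<Sum>z\<in>F4. z * p z) = c" "(\<Sum>z\<in>F4. p z) = d"
    unfolding sum_F4 p by (simp_all add: F4_arith)
qed

text \<open>The coefficients of an expansion in the first coordinate are determined by the function.
  So two expansions of \<open>f\<close> agree, and each coefficient inherits both
  restrictions.\<close>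

lemma bideg_inter:
  assumes "bideg m W f" "bideg m V f"
  shows "bideg m (\<lambda>a b. W a b \<and> V a b) f"
  using assms
proof (induction m arbitrary: W V f)
  case (Suc m)
  from Suc.prems(1) obtain f0 f1 f2 f3 where F: "bideg m W f0" "bideg m (\<lambda>a b. W (Suc a) b) f1"
    "bideg m (\<lambda>a b. W a (Suc b)) f2" "bideg m (\<lambda>a b. W (Suc a) (Suc b)) f3"
    "\<And>z w. z\<in>F4 \<Longrightarrow> w\<in>words m \<Longrightarrow> f (z # w) = f0 w + z * f1 w + z\<^sup>2 * f2 w + z ^ 3 * f3 w"
    by (rule bideg_SucE) (rule that)
  from Suc.prems(2) obtain g0 g1 g2 g3 where G: "bideg m V g0" "bideg m (\<lambda>a b. V (Suc a) b) g1"
    "bideg m (\<lambda>a b. V a (Suc b)) g2" "bideg m (\<lambda>a b. V (Suc a) (Suc b)) g3"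
    "\<And>z w. z\<in>F4 \<Longrightarrow> w\<in>words m \<Longrightarrow> f (z # w) = g0 w + z * g1 w + z\<^sup>2 * g2 w + z ^ 3 * g3 w"
    by (rule bideg_SucE) (rule that)
  have eq: "g0 w = f0 w" "g1 w = f1 w" "g2 w = f2 w" "g3 w = f3 w" if "w \<in> words m" for w
    using coeff_eqs[of "\<lambda>z. f (z # w)", OF F(5)[OF _ that]]
      coeff_eqs[of "\<lambda>z. f (z # w)", OF G(5)[OF _ that]] by simp_all
  note G' = bideg_cong[OF eq(1) G(1)] bideg_cong[OF eq(2) G(2)] bideg_cong[OF eq(3) G(3)]
    bideg_cong[OF eq(4) G(4)]
  show ?case
    by (rule bideg_SucI[OF Suc.IH[OF F(1) G'(1)] Suc.IH[OF F(2) G'(2)] Suc.IH[OF F(3) G'(3)]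
          Suc.IH[OF F(4) G'(4)] F(5)])
qed auto

section \<open>Admissible bidegrees and the weight bound\<close>

definition adm :: "nat \<Rightarrow> int \<Rightarrow> nat \<Rightarrow> nat \<Rightarrow> bool" where
  "adm r s a b \<longleftrightarrow> a + b < r \<or> a + b = r \<and> s \<le> \<bar>int a - int b\<bar>"

text \<open>Twice the minimum weight, in units of the minimum weight \<open>4 ^ m / 2 ^ r\<close> of all functions of
  degree at most \<open>r\<close>.\<close>

definition gain :: "int \<Rightarrow> nat" where
  "gain s = (if s \<le> 1 then 2 else if s = 2 then 3 else 4)"

text \<open>For \<open>r = 0\<close> neither shifted bidegree is admissible, so \<open>f\<close>
  would vanish. This guarantees that \<open>r\<close> can be lowered in the induction.\<close>

lemma bideg_shift:
  assumes "bideg m V f" "\<And>a b. V a b \<Longrightarrow> adm r s (Suc a) b \<or> adm r s a (Suc b)"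
    and "w \<in> words m" "f w \<noteq> 0"
  shows "r > 0"
proof (rule ccontr)
  assume "\<not> r > 0"
  then have "bideg m (\<lambda>a b. False) f"
    using assms(2) by (intro bideg_mono[OF assms(1)]) (auto simp: adm_def)
  then show False
    using bideg_empty assms(3,4) by blast
qed

lemma sum_wt_bound:
  assumes "\<And>z. z \<in> N \<Longrightarrow> g * 4 ^ m \<le> 2 * 2 ^ r * wt m (\<lambda>w. f (z # w))" "N \<subseteq> F4"
  shows "card N * (g * 4 ^ m) \<le> 2 * 2 ^ r * wt (Suc m) f"
proof -
  have "card N * (g * 4 ^ m) \<le> (\<Sum>z\<in>N. 2 * 2 ^ r * wt m (\<lambda>w. f (z # w)))"
    using assms(1) sum_mono[of N "\<lambda>_. g * 4 ^ m"] by simp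
  also have "\<dots> \<le> (\<Sum>z\<in>F4. 2 * 2 ^ r * wt m (\<lambda>w. f (z # w)))"
    using assms(2) finite_F4 by (intro sum_mono2) auto
  finally show ?thesis
    by (simp add: wt_Suc sum_distrib_left)
qed

text \<open>Passing from \<open>m\<close> to \<open>Suc m\<close> costs a factor 4. With 4, 3, 2 or
  1 non-zero restrictions, on which \<open>r\<close> drops by 0, 1, 1 or 2, the induction hypothesis
  yields a factor 4, 6, 4 or 4. The excess in the second case pays for the drop of \<open>s\<close>,
  by \<open>4 * gain s \<le> 6 * gain (s - 1)\<close>, with equality at \<open>s = 2\<close>. As
  \<open>s\<close> may become negative, it is an integer; \<open>s \<le> 0\<close> imposes no
  condition.\<close>

theorem weight_bound:
  assumes "bideg m (adm r s) f" "\<exists>w\<in>words m. f w \<noteq> 0"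
  shows "gain s * 4 ^ m \<le> 2 * 2 ^ r * wt m f"
  using assms
proof (induction m arbitrary: r s f)
  case 0
  then have "{w \<in> words 0. f w \<noteq> 0} = {[]}" "r = 0 \<Longrightarrow> s \<le> 0"
    by (auto simp: adm_def)
  then have "wt 0 f = 1" "r = 0 \<Longrightarrow> s \<le> 0"
    by (simp_all add: wt_def)
  \<comment> \<open>For \<open>r > 0\<close> the right-hand side is at least 4, the largest value of
    \<open>gain\<close>.\<close>
  moreover have "(2::nat) \<le> 2 ^ r" if "r \<noteq> 0"
    using that self_le_power[of 2 r] by simp
  ultimately show ?case
    by (cases "r = 0") (auto simp: gain_def)
next
  case (Suc m)
  from Suc.prems(1) obtain f0 g1 g2 h where *: "bideg m (adm r s) f0"
    "bideg m (\<lambda>a b. adm r s (Suc a) b) g1" "bideg m (\<lambda>a b. adm r s a (Suc b)) g2"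
    "bideg m (\<lambda>a b. adm r s (Suc a) (Suc b)) h"
    and f: "\<And>z w. z\<in>F4 \<Longrightarrow> w\<in>words m \<Longrightarrow> f (z # w) = f0 w + z * g1 w + z\<^sup>2 * g2 w + z ^ 3 * h w"
    by (rule bideg_SucE) (rule that)
  define N where "N = {z \<in> F4. \<exists>w\<in>words m. f (z # w) \<noteq> 0}"
  have N: "N \<subseteq> F4" "finite N" "N \<noteq> {}"
    using finite_F4 Suc.prems(2) by (auto simp: N_def words_Suc)
  have fN: "f (z # w) = 0" if "z \<in> F4" "z \<notin> N" "w \<in> words m" for z w
    using that by (auto simp: N_def)
  \<comment> \<open>Subtracting a vanishing restriction \<open>f (c # w)\<close> eliminates
    \<open>f0\<close>, the only coefficient whose degree is not lowered.\<close>
  have shifted: "bideg m V (\<lambda>w. f (z # w))"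
    if "bideg m V g1" "bideg m V g2" "bideg m V h" "c \<in> F4 - N" "z \<in> F4" for V c z
  proof -
    have "bideg m V (\<lambda>w. (z + c) * g1 w + (z\<^sup>2 + c\<^sup>2) * g2 w + (z ^ 3 + c ^ 3) * h w)"
      using that by (intro bideg_add bideg_cmult)
    moreover have "(z + c) * g1 w + (z\<^sup>2 + c\<^sup>2) * g2 w + (z ^ 3 + c ^ 3) * h w = f (z # w)"
      if w: "w \<in> words m" for w
    proof -
      have "f0 w + (c * g1 w + c\<^sup>2 * g2 w + c ^ 3 * h w) = 0"
        using fN[of c w] f[of c w] w \<open>c \<in> F4 - N\<close> by (simp add: add.assoc)
      then have "f0 w = c * g1 w + c\<^sup>2 * g2 w + c ^ 3 * h w"
        by (rule eq_iff_add_eq_0[THEN iffD2])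
      then show ?thesis
        using f[of z w] w \<open>z \<in> F4\<close> by (simp add: algebra_simps)
    qed
    ultimately show ?thesis
      by (rule bideg_cong[rotated])
  qed
  have weaken: "bideg m V g1" "bideg m V g2" "bideg m V h"
    if "\<And>a b. adm r s (Suc a) b \<Longrightarrow> V a b" "\<And>a b. adm r s a (Suc b) \<Longrightarrow> V a b"
      "\<And>a b. adm r s (Suc a) (Suc b) \<Longrightarrow> V a b" for V
    using that *(2,3,4) by (auto intro: bideg_mono)
  have r_pos: "r > 0" if "c \<in> F4 - N" for c
  proof -
    let ?V = "\<lambda>a b. adm r s (Suc a) b \<or> adm r s a (Suc b)"
    obtain z w where "z \<in> F4" "w \<in> words m" "f (z # w) \<noteq> 0"
      using N(3) by (auto simp: N_def)
    moreover have "bideg m ?V g1" "bideg m ?V g2" "bideg m ?V h"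
      by (rule weaken; auto simp: adm_def)+
    ultimately show ?thesis
      using shifted[of ?V c z] that by (auto intro: bideg_shift)
  qed
  have "card N \<le> 4" "card N > 0"
    using N finite_F4 card_F4 card_mono[of F4 N] by (auto simp: card_gt_0_iff)
  then consider "card N = 4" | "card N = 3" | "card N = 2" | "card N = 1"
    by linarith
  then show ?case
  proof cases
    case 1
    have "gain s * 4 ^ m \<le> 2 * 2 ^ r * wt m (\<lambda>w. f (z # w))" if "z \<in> N" for z
    proof (rule Suc.IH)
      have "bideg m (adm r s) (\<lambda>w. f0 w + z * g1 w + z\<^sup>2 * g2 w + z ^ 3 * h w)"
        using * by (intro bideg_add bideg_cmult) (auto elim!: bideg_mono simp: adm_def)
      then show "bideg m (adm r s) (\<lambda>w. f (z # w))"
        using that by (auto simp: N_def f elim!: bideg_cong[rotated])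
    qed (use that in \<open>auto simp: N_def\<close>)
    from sum_wt_bound[OF this N(1)] 1 show ?thesis
      by simp
  next
    case 2
    \<comment> \<open>The coefficients \<open>g1, g2, h\<close> determine the restrictions, since one of these vanishes; so
      \<open>r\<close> and \<open>s\<close> drop by one.\<close>
    then have "card (F4 - N) = 1"
      using card_F4 N by (simp add: card_Diff_subset)
    then obtain c where c: "c \<in> F4 - N"
      by (auto simp: card_1_singleton_iff)
    then obtain k where k: "r = Suc k"
      using r_pos gr0_conv_Suc by blast
    have "gain (s - 1) * 4 ^ m \<le> 2 * 2 ^ k * wt m (\<lambda>w. f (z # w))" if "z \<in> N" for z
    proof (rule Suc.IH)
      have "bideg m (adm k (s - 1)) g1" "bideg m (adm k (s - 1)) g2" "bideg m (adm k (s - 1)) h"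
        by (rule weaken; auto simp: adm_def k)+
      then show "bideg m (adm k (s - 1)) (\<lambda>w. f (z # w))"
        by (rule shifted) (use c that in \<open>auto simp: N_def\<close>)
    qed (use that in \<open>auto simp: N_def\<close>)
    from sum_wt_bound[OF this N(1)] 2 have "6 * gain (s - 1) * 4 ^ m \<le> 2 * 2 ^ r * wt (Suc m) f"
      by (simp add: k mult_ac)
    moreover have "4 * gain s \<le> 6 * gain (s - 1)"
      by (auto simp: gain_def)
    then have "4 * gain s * 4 ^ m \<le> 6 * gain (s - 1) * 4 ^ m"
      by (rule mult_right_mono) simp
    ultimately show ?thesis
      unfolding power_Suc by linarith
  next
    case 3
    \<comment> \<open>The two vanishing restrictions give a linear relation between \<open>g1, g2, h\<close>, so that modulo
      lower degree \<open>g1\<close> and \<open>g2\<close> are proportional. Then a component of bidegree \<open>(a, b)\<close> of one of them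
      forces both \<open>(a + 1, b)\<close> and \<open>(a, b + 1)\<close> to be admissible, and only \<open>r\<close> drops. For \<open>s = 1\<close>
      this fails at \<open>a = b\<close>, but there nothing better than \<open>s = 0\<close> is claimed.\<close>
    then have "card (F4 - N) = 2"
      using card_F4 N by (simp add: card_Diff_subset)
    then obtain c d where cd: "F4 - N = {c, d}" "c \<noteq> d"
      by (auto simp: card_2_iff)
    then obtain k where k: "r = Suc k"
      using r_pos gr0_conv_Suc by blast
    define t where "t = (if s \<le> 1 then 0 else s)"
    define e where "e = c + d"
    have "e \<noteq> 0"
      using cd(2) eq_iff_add_eq_0[of c d] by (simp add: e_def)
    have rel: "e * g1 w + e\<^sup>2 * g2 w + (c ^ 3 + d ^ 3) * h w = 0" if "w \<in> words m" for w
    proof -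
      have "c \<in> F4" "d \<in> F4" "c \<notin> N" "d \<notin> N" using cd(1) by auto
      then have "f (c # w) + f (d # w) = 0"
        using fN that by simp
      then have "(f0 w + c * g1 w + c\<^sup>2 * g2 w + c ^ 3 * h w) + (f0 w + d * g1 w + d\<^sup>2 * g2 w + d ^ 3 * h w) = 0"
        using \<open>c \<in> F4\<close> \<open>d \<in> F4\<close> that by (simp add: f)
      moreover have "e\<^sup>2 = c\<^sup>2 + d\<^sup>2"
        by (simp add: e_def power2_eq_square algebra_simps)
      ultimately show ?thesis
        by (simp add: e_def algebra_simps)
    qed
    have "bideg m (adm k t) g1"
    proof -
      let ?V = "\<lambda>a b. adm r s a (Suc b) \<or> adm r s (Suc a) (Suc b)"
      have "bideg m ?V (\<lambda>w. e * g2 w + ((c ^ 3 + d ^ 3) / e) * h w)"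
        using *(3,4) by (intro bideg_add bideg_cmult) (auto elim!: bideg_mono)
      moreover have "e * g2 w + ((c ^ 3 + d ^ 3) / e) * h w = g1 w" if "w \<in> words m" for w
        using rel[OF that] \<open>e \<noteq> 0\<close> eq_iff_add_eq_0[of "e * g2 w + ((c ^ 3 + d ^ 3) / e) * h w" "g1 w"]
        by (simp add: field_simps power2_eq_square)
      ultimately have "bideg m ?V g1"
        by (rule bideg_cong[rotated])
      \<comment> \<open>In total degree \<open>k\<close> the part from \<open>h\<close> is absent.
        For \<open>s \<ge> 2\<close>, the lower bound \<open>s\<close> on both
        \<open>\<bar>a + 1 - b\<bar>\<close> and \<open>\<bar>a - b - 1\<bar>\<close> excludes
        \<open>a = b\<close> and then gives \<open>\<bar>a - b\<bar> > s\<close>.\<close>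
      from bideg_inter[OF this *(2)] show ?thesis
        by (rule bideg_mono) (auto simp: adm_def k t_def)
    qed
    moreover have "bideg m (adm k t) g2"
    proof -
      let ?V = "\<lambda>a b. adm r s (Suc a) b \<or> adm r s (Suc a) (Suc b)"
      have "bideg m ?V (\<lambda>w. (1 / e) * g1 w + ((c ^ 3 + d ^ 3) / e\<^sup>2) * h w)"
        using *(2,4) by (intro bideg_add bideg_cmult) (auto elim!: bideg_mono)
      moreover have "(1 / e) * g1 w + ((c ^ 3 + d ^ 3) / e\<^sup>2) * h w = g2 w" if "w \<in> words m" for w
        using rel[OF that] \<open>e \<noteq> 0\<close> eq_iff_add_eq_0[of "(1 / e) * g1 w + ((c ^ 3 + d ^ 3) / e\<^sup>2) * h w" "g2 w"]
        by (simp add: field_simps power2_eq_square)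
      ultimately have "bideg m ?V g2"
        by (rule bideg_cong[rotated])
      from bideg_inter[OF this *(3)] show ?thesis
        by (rule bideg_mono) (auto simp: adm_def k t_def)
    qed
    moreover have "bideg m (adm k t) h"
      using *(4) by (rule bideg_mono) (auto simp: adm_def k)
    ultimately have "bideg m (adm k t) (\<lambda>w. f (z # w))" if "z \<in> F4" for z
      by (rule shifted) (use cd that in auto)
    then have "gain t * 4 ^ m \<le> 2 * 2 ^ k * wt m (\<lambda>w. f (z # w))" if "z \<in> N" for z
      by (rule Suc.IH) (use that in \<open>auto simp: N_def\<close>)
    from sum_wt_bound[OF this N(1)] 3 show ?thesis
      by (auto simp: k t_def gain_def mult_ac)
  next
    case 4
    \<comment> \<open>The only non-zero restriction is the coefficient \<open>h\<close> of \<open>z ^ 3\<close>.\<close>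
    then obtain c where c: "N = {c}"
      by (auto simp: card_1_singleton_iff)
    then have "card (F4 - N) = 3"
      using card_F4 N by (simp add: card_Diff_subset)
    then have "F4 - N \<noteq> {}"
      by force
    then obtain k' where "r = Suc k'"
      using r_pos gr0_conv_Suc by blast
    have h: "h w = f (c # w)" if "w \<in> words m" for w
    proof -
      have "h w = (\<Sum>z\<in>F4. f (z # w))"
        using coeff_eqs(4)[of "\<lambda>z. f (z # w)", OF f[OF _ that]] by simp
      also have "\<dots> = (\<Sum>z\<in>N. f (z # w))"
        using fN that N finite_F4 by (intro sum.mono_neutral_right) auto
      finally show ?thesis using c by simp
    qed
    obtain w where w: "w \<in> words m" "h w \<noteq> 0"
      using c h by (auto simp: N_def)
    \<comment> \<open>A shift by (1, 1) contains a single shift that is admissible for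
      \<open>k'\<close>: raising the larger of \<open>a\<close> and \<open>b\<close> does not
      decrease \<open>\<bar>a - b\<bar>\<close>.\<close>
    have "k' > 0"
      using *(4) _ w by (rule bideg_shift[where s = s]) (auto simp: adm_def \<open>r = Suc k'\<close>)
    then obtain k where k: "r = Suc (Suc k)"
      using \<open>r = Suc k'\<close> gr0_conv_Suc by blast
    have "bideg m (adm k s) h"
      using *(4) by (rule bideg_mono) (auto simp: adm_def k)
    then have "bideg m (adm k s) (\<lambda>w. f (c # w))"
      by (rule bideg_cong[rotated]) (rule h)
    then have "gain s * 4 ^ m \<le> 2 * 2 ^ k * wt m (\<lambda>w. f (z # w))" if "z \<in> N" for z
      using that c w h by (intro Suc.IH) auto
    from sum_wt_bound[OF this N(1)] 4 show ?thesis
      by (simp add: k mult_ac)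
  qed
qed

section \<open>Additive functions\<close>

primrec lin :: "'a list \<Rightarrow> 'a list \<Rightarrow> 'a" where
  "lin [] w = 0"
| "lin (b # bs) w = hd w * b + lin bs (tl w)"

text \<open>Multiplication by a coordinate \<open>z\<close> sends 1, \<open>z\<close>,
  \<open>z\<^sup>2\<close>, \<open>z ^ 3\<close> to \<open>z\<close>, \<open>z\<^sup>2\<close>,
  \<open>z ^ 3\<close>, \<open>z\<close>. This raises \<open>a\<close> by one in the first and third
  case and does not raise the total degree in the others; \<open>V\<close> is assumed to allow for
  both.\<close>

lemma bideg_mult_lin:
  assumes "bideg (length bs) W f" "\<And>a b. W a b \<Longrightarrow> V (Suc a) b"
    and "\<And>a b a' b'. W a b \<Longrightarrow> a' + b' \<le> a + b \<Longrightarrow> V a' b'"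
  shows "bideg (length bs) V (\<lambda>w. lin bs w * f w)"
  using assms
proof (induction bs arbitrary: W V f)
  case (Cons x bs)
  let ?m = "length bs"
  from Cons.prems(1) have "bideg (Suc ?m) W f" by simp
  then obtain f0 g1 g2 h where F: "bideg ?m W f0" "bideg ?m (\<lambda>a b. W (Suc a) b) g1"
    "bideg ?m (\<lambda>a b. W a (Suc b)) g2" "bideg ?m (\<lambda>a b. W (Suc a) (Suc b)) h"
    and f: "\<And>z w. z \<in> F4 \<Longrightarrow> w \<in> words ?m \<Longrightarrow> f (z # w) = f0 w + z * g1 w + z\<^sup>2 * g2 w + z ^ 3 * h w"
    by (rule bideg_SucE) (rule that)
  have "bideg (Suc ?m) V (\<lambda>w. lin (x # bs) w * f w)"
  proof (rule bideg_SucI)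
    show "bideg ?m V (\<lambda>w. lin bs w * f0 w)"
      using F(1) by (rule Cons.IH) (fact Cons.prems(2,3))+
    have "bideg ?m (\<lambda>a b. V (Suc a) b) (\<lambda>w. lin bs w * g1 w)"
      using F(2) by (rule Cons.IH) (erule Cons.prems(2) Cons.prems(3), simp?)+
    moreover have "bideg ?m (\<lambda>a b. V (Suc a) b) f0" "bideg ?m (\<lambda>a b. V (Suc a) b) h"
      by (rule bideg_mono[OF F(1)] bideg_mono[OF F(4)], erule Cons.prems(2) Cons.prems(3), simp?)+
    ultimately show "bideg ?m (\<lambda>a b. V (Suc a) b) (\<lambda>w. lin bs w * g1 w + (x * f0 w + x * h w))"
      by (intro bideg_add bideg_cmult)
    have "bideg ?m (\<lambda>a b. V a (Suc b)) (\<lambda>w. lin bs w * g2 w)"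
      using F(3) by (rule Cons.IH) (erule Cons.prems(2) Cons.prems(3), simp?)+
    moreover have "bideg ?m (\<lambda>a b. V a (Suc b)) g1"
      by (rule bideg_mono[OF F(2)], erule Cons.prems(3), simp)
    ultimately show "bideg ?m (\<lambda>a b. V a (Suc b)) (\<lambda>w. lin bs w * g2 w + x * g1 w)"
      by (intro bideg_add bideg_cmult)
    have "bideg ?m (\<lambda>a b. V (Suc a) (Suc b)) (\<lambda>w. lin bs w * h w)"
      using F(4) by (rule Cons.IH) (erule Cons.prems(2) Cons.prems(3), simp?)+
    moreover have "bideg ?m (\<lambda>a b. V (Suc a) (Suc b)) g2"
      by (rule bideg_mono[OF F(3)], erule Cons.prems(2))
    ultimately show "bideg ?m (\<lambda>a b. V (Suc a) (Suc b)) (\<lambda>w. lin bs w * h w + x * g2 w)"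
      by (intro bideg_add bideg_cmult)
    show "lin (x # bs) (z # w) * f (z # w) = lin bs w * f0 w +
      z * (lin bs w * g1 w + (x * f0 w + x * h w)) + z\<^sup>2 * (lin bs w * g2 w + x * g1 w) +
      z ^ 3 * (lin bs w * h w + x * g2 w)" if "z \<in> F4" "w \<in> words ?m" for z w
    proof -
      have z4: "z * z ^ 3 = z" using F4_pow4[OF that(1)] by (simp add: eval_nat_numeral)
      have "lin (x # bs) (z # w) * f (z # w) = lin bs w * f0 w + z * (lin bs w * g1 w + x * f0 w) +
        z\<^sup>2 * (lin bs w * g2 w + x * g1 w) + z ^ 3 * (lin bs w * h w + x * g2 w) + z * z ^ 3 * (x * h w)"
        unfolding f[OF that] by (simp add: algebra_simps power2_eq_square power3_eq_cube)
      then show ?thesis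
        unfolding z4 by (simp add: algebra_simps)
    qed
  qed
  then show ?case by simp
qed auto

text \<open>Multiplication by a conjugate \<open>z\<^sup>2\<close> sends 1, \<open>z\<close>,
  \<open>z\<^sup>2\<close>, \<open>z ^ 3\<close> to \<open>z\<^sup>2\<close>, \<open>z ^ 3\<close>,
  \<open>z\<close>, \<open>z\<^sup>2\<close>: now \<open>b\<close> rises by one in the first two
  cases.\<close>

lemma bideg_mult_lin_sq:
  assumes "bideg (length bs) W f" "\<And>a b. W a b \<Longrightarrow> V a (Suc b)"
    and "\<And>a b a' b'. W a b \<Longrightarrow> a' + b' \<le> a + b \<Longrightarrow> V a' b'"
  shows "bideg (length bs) V (\<lambda>w. lin bs (map (\<lambda>z. z\<^sup>2) w) * f w)"
  using assms
proof (induction bs arbitrary: W V f)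
  case (Cons x bs)
  let ?m = "length bs" and ?lin = "\<lambda>w. lin bs (map (\<lambda>z. z\<^sup>2) w)"
  from Cons.prems(1) have "bideg (Suc ?m) W f" by simp
  then obtain f0 g1 g2 h where F: "bideg ?m W f0" "bideg ?m (\<lambda>a b. W (Suc a) b) g1"
    "bideg ?m (\<lambda>a b. W a (Suc b)) g2" "bideg ?m (\<lambda>a b. W (Suc a) (Suc b)) h"
    and f: "\<And>z w. z \<in> F4 \<Longrightarrow> w \<in> words ?m \<Longrightarrow> f (z # w) = f0 w + z * g1 w + z\<^sup>2 * g2 w + z ^ 3 * h w"
    by (rule bideg_SucE) (rule that)
  have "bideg (Suc ?m) V (\<lambda>w. lin (x # bs) (map (\<lambda>z. z\<^sup>2) w) * f w)"
  proof (rule bideg_SucI)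
    show "bideg ?m V (\<lambda>w. ?lin w * f0 w)"
      using F(1) by (rule Cons.IH) (fact Cons.prems(2,3))+
    have "bideg ?m (\<lambda>a b. V (Suc a) b) (\<lambda>w. ?lin w * g1 w)"
      using F(2) by (rule Cons.IH) (erule Cons.prems(2) Cons.prems(3), simp?)+
    moreover have "bideg ?m (\<lambda>a b. V (Suc a) b) g2"
      by (rule bideg_mono[OF F(3)], erule Cons.prems(3), simp)
    ultimately show "bideg ?m (\<lambda>a b. V (Suc a) b) (\<lambda>w. ?lin w * g1 w + x * g2 w)"
      by (intro bideg_add bideg_cmult)
    have "bideg ?m (\<lambda>a b. V a (Suc b)) (\<lambda>w. ?lin w * g2 w)"
      using F(3) by (rule Cons.IH) (erule Cons.prems(2) Cons.prems(3), simp?)+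
    moreover have "bideg ?m (\<lambda>a b. V a (Suc b)) f0" "bideg ?m (\<lambda>a b. V a (Suc b)) h"
      by (rule bideg_mono[OF F(1)] bideg_mono[OF F(4)], erule Cons.prems(2) Cons.prems(3), simp?)+
    ultimately show "bideg ?m (\<lambda>a b. V a (Suc b)) (\<lambda>w. ?lin w * g2 w + (x * f0 w + x * h w))"
      by (intro bideg_add bideg_cmult)
    have "bideg ?m (\<lambda>a b. V (Suc a) (Suc b)) (\<lambda>w. ?lin w * h w)"
      using F(4) by (rule Cons.IH) (erule Cons.prems(2) Cons.prems(3), simp?)+
    moreover have "bideg ?m (\<lambda>a b. V (Suc a) (Suc b)) g1"
      by (rule bideg_mono[OF F(2)], erule Cons.prems(2))
    ultimately show "bideg ?m (\<lambda>a b. V (Suc a) (Suc b)) (\<lambda>w. ?lin w * h w + x * g1 w)"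
      by (intro bideg_add bideg_cmult)
    show "lin (x # bs) (map (\<lambda>z. z\<^sup>2) (z # w)) * f (z # w) = ?lin w * f0 w +
      z * (?lin w * g1 w + x * g2 w) + z\<^sup>2 * (?lin w * g2 w + (x * f0 w + x * h w)) +
      z ^ 3 * (?lin w * h w + x * g1 w)" if "z \<in> F4" "w \<in> words ?m" for z w
    proof -
      have z4: "z * z ^ 3 = z" using F4_pow4[OF that(1)] by (simp add: eval_nat_numeral)
      have "lin (x # bs) (map (\<lambda>z. z\<^sup>2) (z # w)) * f (z # w) = ?lin w * f0 w + z * (?lin w * g1 w) +
        z\<^sup>2 * (?lin w * g2 w + x * f0 w) + z ^ 3 * (?lin w * h w + x * g1 w) +
        z * z ^ 3 * (x * g2 w) + z * z ^ 3 * (z * (x * h w))"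
        unfolding f[OF that] by (simp add: algebra_simps power2_eq_square power3_eq_cube)
      then show ?thesis
        unfolding z4 by (simp add: algebra_simps power2_eq_square)
    qed
  qed
  then show ?case by simp
qed auto

section \<open>Frobenius powers of linear forms\<close>

lemma power_2_add: "(x + y) ^ (2 ^ k) = x ^ (2 ^ k) + y ^ (2 ^ k :: nat)" for x y :: 'a
proof (induction k)
  case (Suc k)
  have "(u + v)\<^sup>2 = u\<^sup>2 + v\<^sup>2" for u v :: 'a
    by (simp add: power2_eq_square algebra_simps)
  with Suc show ?case by (simp add: power_mult mult.commute[of 2])
qed simp

lemma F4_power_2: "z \<in> F4 \<Longrightarrow> z ^ (2 ^ k) = (if even k then z else z\<^sup>2)"
proof (induction k)
  case (Suc k)
  have "z ^ 2 ^ Suc k = (z ^ 2 ^ k)\<^sup>2"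
    by (simp add: power_mult mult.commute[of 2])
  also have "\<dots> = (if even k then z\<^sup>2 else z ^ 4)"
    using Suc by (simp flip: power_mult)
  finally show ?case using F4_pow4[OF Suc.prems] by simp
qed simp

text \<open>The Frobenius map is additive and has order two on \<open>F4\<close>: its even powers
  fix the coordinates, its odd powers conjugate them.\<close>

lemma lin_power_2:
  assumes "w \<in> words (length bs)"
  shows "lin bs w ^ (2 ^ k) =
    lin (map (\<lambda>b. b ^ (2 ^ k)) bs) (if even k then w else map (\<lambda>z. z\<^sup>2) w)"
  using assms
proof (induction bs arbitrary: w)
  case (Cons b bs)
  then obtain z v where "w = z # v" "z \<in> F4" "v \<in> words (length bs)"
    by (auto simp: words_Suc)
  with Cons.IH[of v] show ?case
    by (simp add: power_2_add F4_power_2 power_mult_distrib)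
qed simp

text \<open>Each element of \<open>J\<close> contributes a linear form, in the coordinates if it is
  even and in their conjugates if it is odd. Products that repeat a coordinate or a conjugate drop
  in total degree, whence the second alternative.\<close>

lemma bideg_lin_prod:
  assumes "finite J"
  defines "i \<equiv> card {j \<in> J. even j}" and "k \<equiv> card {j \<in> J. odd j}"
  shows "bideg (length bs) (\<lambda>a b. a = i \<and> b = k \<or> a + b < i + k) (\<lambda>w. \<Prod>j\<in>J. lin bs w ^ (2 ^ j))"
  using assms(1) unfolding i_def k_def
proof (induction J)
  case empty
  show ?case by (simp add: bideg_one)
next
  case (insert j J)
  let ?bs = "map (\<lambda>b. b ^ (2 ^ j)) bs"
  let ?F = "\<lambda>w. \<Prod>j\<in>J. lin bs w ^ (2 ^ j)"
  have [simp]: "{i. (i = j \<or> i \<in> J) \<and> P i} = (if P j then insert j {i \<in> J. P i} else {i \<in> J. P i})" for P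
    by auto
  have F: "bideg (length ?bs) (\<lambda>a b. a = card {j \<in> J. even j} \<and> b = card {j \<in> J. odd j} \<or>
      a + b < card {j \<in> J. even j} + card {j \<in> J. odd j}) ?F"
    using insert.IH by simp
  show ?case
  proof (cases "even j")
    case True
    have "bideg (length ?bs) (\<lambda>a b. a = card {i \<in> insert j J. even i} \<and> b = card {i \<in> insert j J. odd i} \<or>
      a + b < card {i \<in> insert j J. even i} + card {i \<in> insert j J. odd i}) (\<lambda>w. lin ?bs w * ?F w)"
      by (rule bideg_mult_lin[OF F]) (use insert.hyps True in auto)
    then show ?thesis
      using True insert.hyps by (auto simp: lin_power_2 elim!: bideg_cong[rotated])
  next
    case False
    have "bideg (length ?bs) (\<lambda>a b. a = card {i \<in> insert j J. even i} \<and> b = card {i \<in> insert j J. odd i} \<or>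
      a + b < card {i \<in> insert j J. even i} + card {i \<in> insert j J. odd i})
      (\<lambda>w. lin ?bs (map (\<lambda>z. z\<^sup>2) w) * ?F w)"
      by (rule bideg_mult_lin_sq[OF F]) (use insert.hyps False in auto)
    then show ?thesis
      using False insert.hyps by (auto simp: lin_power_2 elim!: bideg_cong[rotated])
  qed
qed

section \<open>Bases over \<open>F4\<close> and subspaces over the prime field\<close>

lemma lin_add: "length v = length bs \<Longrightarrow> length w = length bs \<Longrightarrow>
    lin bs (map2 (+) v w) = lin bs v + lin bs w"
proof (induction bs arbitrary: v w)
  case (Cons b bs)
  then show ?case by (cases v; cases w) (auto simp: algebra_simps)
qed simp

lemma lin_cmult: "length w = length bs \<Longrightarrow> lin bs (map ((*) c) w) = c * lin bs w"
proof (induction bs arbitrary: w)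
  case (Cons b bs)
  then show ?case by (cases w) (auto simp: algebra_simps)
qed simp

lemma lin_in:
  assumes "0 \<in> Q" "\<And>x y. x \<in> Q \<Longrightarrow> y \<in> Q \<Longrightarrow> x + y \<in> Q" "\<And>z x. z \<in> F4 \<Longrightarrow> x \<in> Q \<Longrightarrow> z * x \<in> Q"
    and "set bs \<subseteq> Q" "w \<in> words (length bs)"
  shows "lin bs w \<in> Q"
  using assms(4,5)
proof (induction bs arbitrary: w)
  case (Cons b bs)
  then obtain z v where "w = z # v" "z \<in> F4" "v \<in> words (length bs)"
    by (auto simp: words_Suc)
  with Cons show ?case by (simp add: assms)
qed (simp add: assms)

text \<open>Counting replaces dimension theory: for \<open>j < m\<close> the span of
  \<open>j\<close> independent elements has only \<open>4 ^ j < card Q\<close> elements, so another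
  one can be adjoined. The span of \<open>m\<close> independent elements fills
  \<open>Q\<close>.\<close>

lemma basis_exists:
  assumes "0 \<in> Q" "\<And>x y. x \<in> Q \<Longrightarrow> y \<in> Q \<Longrightarrow> x + y \<in> Q" "\<And>z x. z \<in> F4 \<Longrightarrow> x \<in> Q \<Longrightarrow> z * x \<in> Q"
    and card: "card Q = 4 ^ m"
  obtains bs where "length bs = m" "bij_betw (lin bs) (words m) Q"
proof -
  have fin: "finite Q" using card by (intro card_ge_0_finite) simp
  have "\<exists>bs. length bs = j \<and> set bs \<subseteq> Q \<and> inj_on (lin bs) (words j)" if "j \<le> m" for j
    using that
  proof (induction j)
    case (Suc j)
    then obtain bs where bs: "length bs = j" "set bs \<subseteq> Q" "inj_on (lin bs) (words j)"
      by auto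
    have "card (lin bs ` words j) < card Q"
      using Suc.prems card by (simp add: card_image[OF bs(3)] card_words)
    moreover have "lin bs ` words j \<subseteq> Q"
      using lin_in[OF assms(1-3) bs(2)] bs(1) by auto
    ultimately obtain b where b: "b \<in> Q" "b \<notin> lin bs ` words j"
      by (metis less_irrefl subsetI subset_antisym)
    have "inj_on (lin (b # bs)) (words (Suc j))"
    proof (rule inj_onI)
      fix x y assume "x \<in> words (Suc j)" "y \<in> words (Suc j)" and eq: "lin (b # bs) x = lin (b # bs) y"
      then obtain z v z' v' where x: "x = z # v" "z \<in> F4" "v \<in> words j"
        and y: "y = z' # v'" "z' \<in> F4" "v' \<in> words j"
        by (auto simp: words_Suc)
      have len: "length v = length bs" "length v' = length bs"
        using x y bs by (auto simp: words_def)
      have "(z + z') * b + (lin bs v + lin bs v') = 0"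
        using eq eq_iff_add_eq_0[of "lin (b # bs) x"] by (simp add: x y algebra_simps)
      then have eq': "(z + z') * b = lin bs v + lin bs v'"
        by (rule eq_iff_add_eq_0[THEN iffD2])
      have "z = z'"
      proof (rule ccontr)
        assume "z \<noteq> z'"
        then have nz: "z + z' \<noteq> 0" using eq_iff_add_eq_0 by blast
        \<comment> \<open>Division by \<open>z + z'\<close>, whose inverse lies in
          \<open>F4\<close>, puts \<open>b\<close> into the span of \<open>bs\<close>.\<close>
        have "b = inverse (z + z') * (lin bs v + lin bs v')"
          using nz unfolding eq'[symmetric] by (simp flip: mult.assoc)
        also have "\<dots> = lin bs (map ((*) (inverse (z + z'))) (map2 (+) v v'))"
          using len by (simp add: lin_add lin_cmult del: map_map)
        finally have "b = lin bs (map ((*) (inverse (z + z'))) (map2 (+) v v'))" .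
        moreover have "map ((*) (inverse (z + z'))) (map2 (+) v v') \<in> words j"
          using x y by (auto simp: words_def elim!: in_set_zipE intro!: F4_closed F4_inverse)
        ultimately show False using b by blast
      qed
      with eq' have "lin bs v = lin bs v'"
        using eq_iff_add_eq_0[of "lin bs v"] by simp
      with bs(3) x y \<open>z = z'\<close> show "x = y" by (auto dest: inj_onD)
    qed
    with bs b show ?case by (intro exI[of _ "b # bs"]) (simp del: lin.simps)
  qed auto
  then obtain bs where bs: "length bs = m" "set bs \<subseteq> Q" "inj_on (lin bs) (words m)"
    by blast
  then have "lin bs ` words m = Q"
    using lin_in[OF assms(1-3) bs(2)] card fin
    by (intro card_subset_eq) (auto simp: card_image card_words)
  with bs that show thesis by (auto simp: bij_betw_def)
qed

text \<open>\<open>U\<close> is a subspace over the prime field, doubled in each step by a coset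
  \<open>b + U\<close>. By additivity of Frobenius, the product at \<open>b + x\<close> expands over
  the subsets of \<open>J\<close>. Proper subsets contribute 0 by induction, and the term of
  \<open>J\<close> itself cancels against the sum over \<open>U\<close>.\<close>

lemma power_sum_subspace:
  assumes "0 \<in> Q" "\<And>x y. x \<in> Q \<Longrightarrow> y \<in> Q \<Longrightarrow> x + y \<in> Q" and card: "card Q = 2 ^ n" and "d \<le> n"
  shows "\<exists>U\<subseteq>Q. 0 \<in> U \<and> card U = 2 ^ d \<and>
    (\<forall>J. finite J \<and> card J < d \<longrightarrow> (\<Sum>x\<in>U. \<Prod>j\<in>J. x ^ (2 ^ j)) = (0::'a))"
proof -
  have fin: "finite Q" using card by (intro card_ge_0_finite) simp
  \<comment> \<open>Closure under addition is carried along for the induction: it makes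
    \<open>U\<close> and \<open>b + U\<close> disjoint.\<close>
  have "\<exists>U\<subseteq>Q. 0 \<in> U \<and> card U = 2 ^ d \<and> (\<forall>x\<in>U. \<forall>y\<in>U. x + y \<in> U) \<and>
    (\<forall>J. finite J \<and> card J < d \<longrightarrow> (\<Sum>x\<in>U. \<Prod>j\<in>J. x ^ (2 ^ j)) = (0::'a))"
    using \<open>d \<le> n\<close>
  proof (induction d)
    case 0
    then show ?case using assms(1) by (intro exI[of _ "{0}"]) auto
  next
    case (Suc d)
    then obtain U where U: "U \<subseteq> Q" "0 \<in> U" "card U = 2 ^ d" "\<And>x y. x \<in> U \<Longrightarrow> y \<in> U \<Longrightarrow> x + y \<in> U"
      and J: "\<And>J. finite J \<Longrightarrow> card J < d \<Longrightarrow> (\<Sum>x\<in>U. \<Prod>j\<in>J. x ^ (2 ^ j)) = (0::'a)"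
      by (auto simp: Ball_def)
    have finU: "finite U" using fin U(1) finite_subset by blast
    have "card U < card Q" using Suc.prems card U(3) by simp
    then obtain b where b: "b \<in> Q" "b \<notin> U"
      using U(1) by (metis less_irrefl subsetI subset_antisym)
    have disj: "U \<inter> (+) b ` U = {}"
    proof -
      have "b + x \<notin> U" if "x \<in> U" for x
        using U(4)[of "b + x" x] that b(2) by (auto simp: add.assoc)
      then show ?thesis by auto
    qed
    have 1: "card (U \<union> (+) b ` U) = 2 ^ Suc d"
      using disj finU U(3) by (simp add: card_Un_disjoint card_image)
    have 2: "x + y \<in> U \<union> (+) b ` U" if "x \<in> U \<union> (+) b ` U" "y \<in> U \<union> (+) b ` U" for x y
    proof -
      have *: "(\<exists>u\<in>U. x = u \<or> x = b + u) \<Longrightarrow> x \<in> U \<union> (+) b ` U" for x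
        by auto
      from that obtain u v where uv: "u \<in> U" "v \<in> U" "x = u \<or> x = b + u" "y = v \<or> y = b + v"
        by blast
      then have "x + y = u + v \<or> x + y = b + (u + v)"
        by (auto simp: ac_simps)
      then show ?thesis using U(4)[OF uv(1,2)] * by blast
    qed
    have 3: "(\<Sum>x\<in>U \<union> (+) b ` U. \<Prod>j\<in>J. x ^ (2 ^ j)) = 0" if "finite J" "card J < Suc d" for J
    proof -
      have "(\<Sum>x\<in>(+) b ` U. \<Prod>j\<in>J. x ^ (2 ^ j)) = (\<Sum>x\<in>U. \<Prod>j\<in>J. x ^ (2 ^ j) + b ^ (2 ^ j))"
        by (subst sum.reindex) (auto simp: power_2_add add.commute)
      also have "\<dots> = (\<Sum>x\<in>U. \<Sum>S\<in>Pow J. (\<Prod>j\<in>S. x ^ (2 ^ j)) * (\<Prod>j\<in>J - S. b ^ (2 ^ j)))"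
        using that(1) by (simp add: prod_add)
      also have "\<dots> = (\<Sum>S\<in>Pow J. (\<Sum>x\<in>U. \<Prod>j\<in>S. x ^ (2 ^ j)) * (\<Prod>j\<in>J - S. b ^ (2 ^ j)))"
        by (subst sum.swap) (simp add: sum_distrib_right)
      also have "\<dots> = (\<Sum>S\<in>{J}. (\<Sum>x\<in>U. \<Prod>j\<in>S. x ^ (2 ^ j)) * (\<Prod>j\<in>J - S. b ^ (2 ^ j)))"
      proof (intro sum.mono_neutral_right ballI)
        fix S assume "S \<in> Pow J - {J}"
        then have "S \<subset> J" by auto
        then have "finite S" "card S < card J"
          using that(1) by (auto intro: finite_subset psubset_card_mono)
        with J[of S] that(2) show "(\<Sum>x\<in>U. \<Prod>j\<in>S. x ^ (2 ^ j)) * (\<Prod>j\<in>J - S. b ^ (2 ^ j)) = 0"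
          by simp
      qed (use that in auto)
      finally have "(\<Sum>x\<in>(+) b ` U. \<Prod>j\<in>J. x ^ (2 ^ j)) = (\<Sum>x\<in>U. \<Prod>j\<in>J. x ^ (2 ^ j))"
        by simp
      with disj finU show ?thesis by (simp add: sum.union_disjoint)
    qed
    have 4: "U \<union> (+) b ` U \<subseteq> Q" using U(1) b(1) assms(2) by auto
    show ?case
      by (rule exI[of _ "U \<union> (+) b ` U"]) (use 1 2 3 4 U(2) in blast)
  qed
  then obtain U :: "'a set" where "U \<subseteq> Q" "0 \<in> U" "card U = 2 ^ d"
    and "\<forall>J. finite J \<and> card J < d \<longrightarrow> (\<Sum>x\<in>U. \<Prod>j\<in>J. x ^ (2 ^ j)) = 0"
    by (elim exE conjE)
  then show ?thesis
    by (intro exI[of _ U] conjI)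
qed

end

section \<open>Binary digits of exponents\<close>

lemma bit_complement:
  assumes "u < 2 ^ N" "j < N"
  shows "bit (2 ^ N - 1 - u :: nat) j \<longleftrightarrow> \<not> bit u j"
proof -
  have "int (2 ^ N - 1 - u) = mask N - take_bit N (int u)"
    using assms by (simp add: take_bit_int_eq_self mask_eq_exp_minus_1 of_nat_diff)
  then have "bit (int (2 ^ N - 1 - u)) j \<longleftrightarrow> \<not> bit (int u) j"
    unfolding take_bit_not_eq_mask_diff[symmetric] using assms by (simp add: bit_simps)
  then show ?thesis
    by (simp add: bit_of_nat_iff)
qed

definition digits :: "nat \<Rightarrow> nat \<Rightarrow> nat set" where
  "digits m u = {j. j < 2 * m \<and> bit u j}"

lemma finite_digits: "finite (digits m u)"
  by (simp add: digits_def)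

lemma power_eq_prod_digits:
  fixes x :: "'a::comm_monoid_mult"
  assumes "u < 4 ^ m"
  shows "x ^ u = (\<Prod>j\<in>digits m u. x ^ (2 ^ j))"
proof -
  have "u = take_bit (2 * m) u"
    using assms by (simp add: take_bit_nat_eq_self power_mult)
  also have "\<dots> = (\<Sum>j<2 * m. of_bool (bit u j) * 2 ^ j)"
    by (simp add: take_bit_sum push_bit_of_1 push_bit_eq_mult lessThan_atLeast0)
  also have "\<dots> = (\<Sum>j\<in>digits m u. 2 ^ j)"
    unfolding digits_def by (intro sum.mono_neutral_cong_right) auto
  finally show ?thesis
    by (metis power_sum)
qed

lemma wt2_eq_card: "wt2 m u = card (digits m u)"
proof -
  have "{..<2 * m} \<inter> {j. bit u j} = digits m u"
    by (auto simp: digits_def)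
  then show ?thesis
    by (simp add: wt2_def sum.If_cases of_bool_def)
qed

lemma even_wt_eq_card: "even_wt m u = card {j \<in> digits m u. even j}"
proof -
  have "{j \<in> digits m u. even j} = (*) 2 ` {i. i < m \<and> bit u (2 * i)}"
    by (auto simp: digits_def elim!: evenE)
  then show ?thesis
    by (simp add: even_wt_def card_image inj_on_def)
qed

lemma odd_wt_eq_card: "odd_wt m u = card {j \<in> digits m u. odd j}"
proof -
  have "{j \<in> digits m u. odd j} = (\<lambda>i. 2 * i + 1) ` {i. i < m \<and> bit u (2 * i + 1)}"
    by (auto simp: digits_def elim!: oddE)
  then show ?thesis
    by (simp add: odd_wt_def card_image inj_on_def)
qed

lemma wt2_eq_sum: "wt2 m u = even_wt m u + odd_wt m u"
proof -
  have "digits m u = {j \<in> digits m u. even j} \<union> {j \<in> digits m u. odd j}"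
    by auto
  then have "card (digits m u) = card {j \<in> digits m u. even j} + card {j \<in> digits m u. odd j}"
    using finite_digits by (metis (no_types, lifting) card_Un_disjoint finite_Un disjoint_iff mem_Collect_eq)
  then show ?thesis
    by (simp add: wt2_eq_card even_wt_eq_card odd_wt_eq_card)
qed

text \<open>All \<open>2 * m\<close> binary digits of \<open>code_length m\<close> are 1, so
  subtracting \<open>u\<close> from it flips the digits of \<open>u\<close>. This links the
  exponents of the zeros with the complementary exponents in the Fourier expansion.\<close>

lemma complement_weights:
  assumes "u \<le> code_length m"
  shows "even_wt m (code_length m - u) + even_wt m u = m"
    and "odd_wt m (code_length m - u) + odd_wt m u = m"
proof -
  have bits: "bit (code_length m - u) j \<longleftrightarrow> \<not> bit u j" if "j < 2 * m" for j
  proof -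
    have "u < 2 ^ (2 * m)"
      using assms le_imp_less_Suc[OF assms] by (simp add: code_length_def power_mult)
    from bit_complement[OF this that] show ?thesis
      by (simp add: code_length_def power_mult)
  qed
  have "card {i. i < m \<and> P i} + card {i. i < m \<and> \<not> P i} = m" for P
  proof -
    have "{i. i < m \<and> P i} \<union> {i. i < m \<and> \<not> P i} = {..<m}" by auto
    then show ?thesis
      by (subst card_Un_disjoint[symmetric]) auto
  qed
  note * = this
  have "{i. i < m \<and> bit (code_length m - u) (2 * i)} = {i. i < m \<and> \<not> bit u (2 * i)}"
    using bits by auto
  then show "even_wt m (code_length m - u) + even_wt m u = m"
    using *[of "\<lambda>i. bit u (2 * i)"] by (simp add: even_wt_def)
  have "{i. i < m \<and> bit (code_length m - u) (2 * i + 1)} = {i. i < m \<and> \<not> bit u (2 * i + 1)}"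
    using bits by auto
  then show "odd_wt m (code_length m - u) + odd_wt m u = m"
    using *[of "\<lambda>i. bit u (2 * i + 1)"] by (simp add: odd_wt_def)
qed

lemma (in gf4) bideg_lin_power:
  assumes "u < 4 ^ length bs"
  shows "bideg (length bs) (\<lambda>a b. a = even_wt (length bs) u \<and> b = odd_wt (length bs) u \<or>
    a + b < wt2 (length bs) u) (\<lambda>w. lin bs w ^ u)"
  using bideg_lin_prod[OF finite_digits[of "length bs" u], of bs]
  by (simp add: power_eq_prod_digits[OF assms] even_wt_eq_card odd_wt_eq_card wt2_eq_sum)

section \<open>The codes\<close>

locale root_of_unity =
  fixes m :: nat and \<zeta> :: "bit alg_closure"
  assumes m_pos: "1 \<le> m" and primitive: "primitive_root_of_unity (code_length m) \<zeta>"
begin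

abbreviation n :: nat where
  "n \<equiv> code_length m"

lemma Suc_n: "Suc n = 4 ^ m"
  by (simp add: code_length_def)

lemma two_eq_0: "(2 :: bit alg_closure) = 0"
  by (metis bit_2_eq_0 to_ac_0 to_ac_numeral)

lemma zeta_n: "\<zeta> ^ n = 1" and n_pos: "n > 0"
  and zeta_k: "0 < k \<Longrightarrow> k < n \<Longrightarrow> \<zeta> ^ k \<noteq> 1"
  using primitive by (auto simp: primitive_root_of_unity_def)

lemma zeta_nonzero: "\<zeta> \<noteq> 0"
  using zeta_n n_pos by (auto simp: power_0_left)

lemma zeta_power_eq:
  assumes "\<zeta> ^ u = \<zeta> ^ v" "u \<le> v" "v < u + n"
  shows "u = v"
proof -
  have "\<zeta> ^ u * \<zeta> ^ (v - u) = \<zeta> ^ u * 1"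
    using assms(1,2) by (metis le_add_diff_inverse mult.right_neutral power_add)
  then have "\<zeta> ^ (v - u) = 1"
    using zeta_nonzero by (simp only: mult_cancel_left power_eq_0_iff) auto
  then show ?thesis
    using zeta_k[of "v - u"] assms by (cases "u = v") auto
qed

text \<open>As 3 divides \<open>4 ^ m - 1\<close>, this power of \<open>\<zeta>\<close> is a
  primitive cube root of unity, which generates the field of four elements.\<close>

lemma omega_root: "(\<zeta> ^ (n div 3))\<^sup>2 = \<zeta> ^ (n div 3) + 1"
proof -
  define w where "w = \<zeta> ^ (n div 3)"
  have "(4::nat) ^ m mod 3 = 1"
    using power_mod[of "4::nat" 3 m] by simp
  then have "n mod 3 = 0"
    using Suc_n by presburger
  then have n3: "n = 3 * (n div 3)"
    by presburger
  then have "w ^ 3 = 1"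
    using zeta_n by (simp add: w_def mult.commute flip: power_mult)
  moreover have "w \<noteq> 1"
    unfolding w_def using n3 n_pos by (intro zeta_k) linarith+
  moreover have "(w - 1) * (w\<^sup>2 + w + 1) = w ^ 3 - 1"
    by (simp add: algebra_simps power2_eq_square power3_eq_cube)
  ultimately have "w\<^sup>2 + w + 1 = 0"
    by simp
  moreover have "w + w = 0" "(1::bit alg_closure) + 1 = 0"
    using two_eq_0 mult_2[of w] by simp_all
  ultimately show ?thesis
    unfolding w_def[symmetric] by (metis add.assoc add.left_commute add_0_right add_right_imp_eq)
qed

sublocale gf4 "\<zeta> ^ (n div 3)"
  by unfold_locales (fact two_eq_0 omega_root)+

text \<open>The subfield of order \<open>4 ^ m\<close>, as the set of fixed points of a power of
  Frobenius.\<close>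

definition Q :: "bit alg_closure set" where
  "Q = {x. x ^ (4 ^ m) = x}"

text \<open>The coordinates of the extended code, the last one belonging to the point 0.\<close>

definition pt :: "nat \<Rightarrow> bit alg_closure" where
  "pt i = (if i < n then \<zeta> ^ i else 0)"

lemma pt_in_Q: "pt i \<in> Q"
proof -
  have "(\<zeta> ^ i) ^ (4 ^ m) = \<zeta> ^ i * (\<zeta> ^ n) ^ i"
    unfolding Suc_n[symmetric] by (simp add: mult.commute flip: power_mult)
  then show ?thesis
    using zeta_n by (simp add: pt_def Q_def)
qed

lemma inj_on_pt: "inj_on pt {..<Suc n}"
proof (rule inj_onI)
  fix i j assume ij: "i \<in> {..<Suc n}" "j \<in> {..<Suc n}" "pt i = pt j"
  then show "i = j"
    using zeta_power_eq[of i j] zeta_power_eq[of j i] zeta_nonzero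
    by (cases i j rule: linorder_cases) (auto simp: pt_def split: if_splits)
qed

text \<open>The points are \<open>4 ^ m\<close> distinct roots of \<open>x ^ (4 ^ m) + x\<close>,
  whose degree allows no more.\<close>

lemma bij_betw_pt: "bij_betw pt {..<Suc n} Q" and card_Q: "card Q = 4 ^ m"
proof -
  define p :: "bit alg_closure poly" where "p = monom 1 (4 ^ m) + [:0, 1:]"
  have deg: "degree p = 4 ^ m"
  proof -
    have "(1::nat) < 4 ^ m"
      using m_pos by (intro one_less_power) auto
    then have "degree ([:0, 1:] :: bit alg_closure poly) < degree (monom (1::bit alg_closure) (4 ^ m))"
      by (simp add: degree_monom_eq)
    then show ?thesis
      unfolding p_def by (subst degree_add_eq_left) (simp_all add: degree_monom_eq)
  qed
  then have "p \<noteq> 0"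
    by (metis degree_0 power_not_zero zero_neq_numeral)
  moreover have "Q = {x. poly p x = 0}"
    by (auto simp: Q_def p_def poly_monom simp flip: eq_iff_add_eq_0)
  ultimately have "finite Q" "card Q \<le> 4 ^ m"
    using card_poly_roots_bound[of p] poly_roots_finite[of p] deg by simp_all
  moreover have "card (pt ` {..<Suc n}) = 4 ^ m"
    using inj_on_pt Suc_n by (simp add: card_image)
  moreover have "pt ` {..<Suc n} \<subseteq> Q"
    using pt_in_Q by auto
  ultimately have "pt ` {..<Suc n} = Q"
    by (intro card_seteq) auto
  then show "bij_betw pt {..<Suc n} Q" "card Q = 4 ^ m"
    using inj_on_pt \<open>card (pt ` _) = _\<close> by (auto simp: bij_betw_def)
qed

lemma Q_0: "0 \<in> Q"
  by (simp add: Q_def)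

lemma Q_add: "x \<in> Q \<Longrightarrow> y \<in> Q \<Longrightarrow> x + y \<in> Q"
  using power_2_add[of x y "2 * m"] by (simp add: Q_def power_mult)

lemma Q_mult: "z \<in> F4 \<Longrightarrow> x \<in> Q \<Longrightarrow> z * x \<in> Q"
  using F4_power_2[of z "2 * m"] by (simp add: Q_def power_mult power_mult_distrib)

section \<open>Fourier inversion for codewords\<close>

definition syndrome :: "bit vec \<Rightarrow> nat \<Rightarrow> bit alg_closure" where
  "syndrome c u = (\<Sum>i<n. to_ac (c $ i) * (\<zeta> ^ u) ^ i)"

text \<open>Orthogonality of the characters of a cyclic group of order \<open>n\<close>. No factor
  \<open>1 / n\<close> appears, since \<open>n + 1 = 4 ^ m\<close> vanishes in characteristic two
  and so \<open>n\<close> equals 1 there. Off the diagonal, the sum is up to a factor the cofactor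
  of \<open>x - y\<close> in \<open>x ^ n - y ^ n = 0\<close>.\<close>

lemma sum_powers:
  assumes "i < n" "j < n"
  shows "(\<Sum>v<n. (\<zeta> ^ Suc v) ^ j * (\<zeta> ^ i) ^ (n - Suc v)) = of_bool (i = j)"
proof (cases "i = j")
  case True
  have "(\<zeta> ^ Suc v) ^ i * (\<zeta> ^ i) ^ (n - Suc v) = (\<zeta> ^ n) ^ i" if "v < n" for v
  proof -
    have "Suc v * i + i * (n - Suc v) = n * i"
      using that by (metis Suc_leI add_mult_distrib2 le_add_diff_inverse mult.commute)
    then show ?thesis
      by (simp flip: power_mult power_add del: power_Suc)
  qed
  then have "(\<Sum>v<n. (\<zeta> ^ Suc v) ^ i * (\<zeta> ^ i) ^ (n - Suc v)) = of_nat n"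
    using zeta_n by simp
  also have "of_nat n = (1 :: bit alg_closure)"
  proof -
    have "(4 :: bit alg_closure) = 2 + 2"
      by (subst numeral_plus_numeral) (simp only: num.inject add_num_simps)
    also have "\<dots> = 0"
      by (rule add_self)
    finally have "of_nat (Suc n) = (0 :: bit alg_closure)"
      unfolding Suc_n using m_pos by (simp add: power_0_left)
    then show ?thesis
      using eq_iff_add_eq_0[of "of_nat n" 1] by (simp add: add.commute)
  qed
  finally show ?thesis using True by simp
next
  case False
  let ?x = "\<zeta> ^ j" and ?y = "\<zeta> ^ i"
  have "?x \<noteq> ?y"
    using False assms zeta_power_eq[of i j] zeta_power_eq[of j i]
    by (cases i j rule: linorder_cases) auto
  then have "?x + ?y \<noteq> 0"
    by (simp flip: eq_iff_add_eq_0)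
  moreover have "(\<zeta> ^ k) ^ n = 1" for k
    by (metis power_mult mult.commute zeta_n power_one)
  then have "(?x - ?y) * (\<Sum>v<n. ?y ^ (n - Suc v) * ?x ^ v) = 0"
    using power_diff_sumr2[of ?x n ?y] by simp
  ultimately have "(\<Sum>v<n. ?y ^ (n - Suc v) * ?x ^ v) = 0"
    by simp
  then have "?x * (\<Sum>v<n. ?y ^ (n - Suc v) * ?x ^ v) = 0"
    by simp
  moreover have "?x * (?y ^ (n - Suc v) * ?x ^ v) = (\<zeta> ^ Suc v) ^ j * ?y ^ (n - Suc v)" for v
    by (simp add: algebra_simps flip: power_mult)
  ultimately show ?thesis
    using False by (simp add: sum_distrib_left)
qed

text \<open>The frequencies run from 1 to \<open>n\<close>, so that the exponents run from
  \<open>n - 1\<close> down to 0. At the point 0 only the exponent 0 survives, by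
  \<open>0 ^ 0 = 1\<close>. Its coefficient is the syndrome at \<open>n\<close>, which is the parity
  coordinate because \<open>\<zeta> ^ n = 1\<close>. So one formula covers all coordinates.\<close>

lemma extend_eq_sum_syndromes:
  assumes "c \<in> carrier_vec n" "i < Suc n"
  shows "to_ac (extend_vec c $ i) = (\<Sum>v<n. syndrome c (Suc v) * pt i ^ (n - Suc v))"
proof (cases "i < n")
  case True
  have "(\<Sum>v<n. syndrome c (Suc v) * pt i ^ (n - Suc v)) =
      (\<Sum>v<n. \<Sum>j<n. to_ac (c $ j) * ((\<zeta> ^ Suc v) ^ j * (\<zeta> ^ i) ^ (n - Suc v)))"
    using True by (simp add: syndrome_def pt_def sum_distrib_right mult.assoc)
  also have "\<dots> = (\<Sum>j<n. to_ac (c $ j) * (\<Sum>v<n. (\<zeta> ^ Suc v) ^ j * (\<zeta> ^ i) ^ (n - Suc v)))"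
    by (subst sum.swap) (simp add: sum_distrib_left)
  also have "\<dots> = (\<Sum>j<n. to_ac (c $ j) * of_bool (i = j))"
    using True by (intro sum.cong refl) (simp add: sum_powers del: power_Suc)
  also have "\<dots> = to_ac (c $ i)"
    using True by (simp add: of_bool_def if_distrib cong: if_cong)
  finally show ?thesis
    using True assms by (simp add: extend_vec_def)
next
  case False
  then have "(\<Sum>v<n. syndrome c (Suc v) * pt i ^ (n - Suc v)) =
      (\<Sum>v\<in>{n - 1}. syndrome c (Suc v) * pt i ^ (n - Suc v))"
    using n_pos by (intro sum.mono_neutral_right) (auto simp: pt_def power_0_left)
  also have "\<dots> = (\<Sum>j<n. to_ac (c $ j))"
    using n_pos zeta_n by (simp add: syndrome_def)
  finally show ?thesis
    using False assms by (auto simp: extend_vec_def to_ac_sum)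
qed

section \<open>Codewords as functions with restricted bidegrees\<close>

definition zeros :: "nat \<Rightarrow> int set \<Rightarrow> bit alg_closure set" where
  "zeros r I = Z_pred m \<zeta> r - (\<Union>k\<in>I. Theta m \<zeta> r k)"

lemma syndrome_zero: "c \<in> cyclic_code n Z \<Longrightarrow> \<zeta> ^ u \<in> Z \<Longrightarrow> syndrome c u = 0"
  by (auto simp: cyclic_code_def syndrome_def)

text \<open>A term survives only if \<open>\<zeta> ^ u\<close>, with \<open>u = Suc v\<close>, is
  not a zero. Then either \<open>u\<close> has weight above \<open>2 * m - r\<close>, or
  \<open>\<zeta> ^ u\<close> lies in \<open>Theta m \<zeta> r k\<close> for some
  \<open>k \<in> I\<close>. For the exponent \<open>n - u\<close> this means weight below
  \<open>r\<close>, or weight \<open>r\<close> with digit imbalance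
  \<open>m - k \<ge> t\<close>.\<close>

lemma bideg_syndrome:
  assumes c: "c \<in> cyclic_code n (zeros r I)" and r: "1 \<le> r" "r \<le> 2 * m - 1"
    and I: "\<And>k. k \<in> I \<Longrightarrow> t \<le> int m - k"
    and bs: "length bs = m" and v: "v < n"
  shows "bideg m (adm r t) (\<lambda>w. syndrome c (Suc v) * lin bs w ^ (n - Suc v))"
proof (cases "\<zeta> ^ Suc v \<in> zeros r I")
  case True
  then show ?thesis
    using syndrome_zero[OF c] bideg_zero by (simp del: power_Suc)
next
  case False
  let ?u = "Suc v"
  let ?s = "n - ?u"
  have u: "?u \<le> n" using v by simp
  note compl = complement_weights[OF u]
  have "wt2 m ?s < r \<or> wt2 m ?s = r \<and> t \<le> \<bar>int (even_wt m ?s) - int (odd_wt m ?s)\<bar>"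
  proof (cases "int (wt2 m ?u) \<le> 2 * int m - int r")
    case True
    then have "\<zeta> ^ ?u \<in> Z_pred m \<zeta> r"
      unfolding Z_pred_def using u by blast
    with False obtain k where k: "k \<in> I" "\<zeta> ^ ?u \<in> Theta m \<zeta> r k"
      by (auto simp: zeros_def simp del: power_Suc)
    then obtain u' where u': "\<zeta> ^ ?u = \<zeta> ^ u'" "u' \<le> n" "int (wt2 m u') = 2 * int m - int r"
      "\<bar>int (odd_wt m u') - int (even_wt m u')\<bar> = int m - k"
      by (auto simp: Theta_def simp del: power_Suc)
    \<comment> \<open>\<open>Theta\<close> admits the exponent 0, which represents the same element
      as \<open>n\<close>. It is excluded by its weight, since \<open>r < 2 * m\<close>; between 1
      and \<open>n\<close> the exponent is unique.\<close>
    have "u' \<noteq> 0"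
    proof
      assume "u' = 0"
      then have "wt2 m u' = 0" by (simp add: wt2_def)
      with u'(3) r show False by simp
    qed
    then have "u' = ?u"
      using u u' zeta_power_eq[of ?u u'] zeta_power_eq[of u' ?u] by (cases u' ?u rule: linorder_cases) auto
    note u'(3,4)[unfolded this]
    moreover from compl have "int (even_wt m ?s) - int (odd_wt m ?s) = int (odd_wt m ?u) - int (even_wt m ?u)"
      by linarith
    ultimately have "t \<le> \<bar>int (even_wt m ?s) - int (odd_wt m ?s)\<bar>"
      using I[OF k(1)] by simp
    moreover have "wt2 m ?s = r"
      using compl \<open>int (wt2 m ?u) = _\<close> unfolding wt2_eq_sum by linarith
    ultimately show ?thesis
      by simp
  next
    case False
    with compl show ?thesis
      unfolding wt2_eq_sum by linarith
  qed
  moreover have "bideg m (\<lambda>a b. a = even_wt m ?s \<and> b = odd_wt m ?s \<or> a + b < wt2 m ?s) (\<lambda>w. lin bs w ^ ?s)"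
    using bideg_lin_power[of ?s bs] bs Suc_n by simp
  ultimately have "bideg m (adm r t) (\<lambda>w. lin bs w ^ ?s)"
    by (elim bideg_mono) (auto simp: adm_def wt2_eq_sum)
  then show ?thesis
    by (rule bideg_cmult)
qed

text \<open>The difference of the extended codewords, in characteristic two their sum, is a function
  on \<open>Q\<close> by Fourier inversion. In coordinates over \<open>F4\<close> it falls under
  \<open>weight_bound\<close>.\<close>

lemma hamming_dist_bound:
  assumes c: "c \<in> cyclic_code n (zeros r I)" and d: "d \<in> cyclic_code n (zeros r I)"
    and neq: "extend_vec c \<noteq> extend_vec d"
    and r: "1 \<le> r" "r \<le> 2 * m - 1" and I: "\<And>k. k \<in> I \<Longrightarrow> t \<le> int m - k"
  shows "gain t * 4 ^ m \<le> 2 * 2 ^ r * hamming_dist (extend_vec c) (extend_vec d)"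
proof -
  obtain bs where bs: "length bs = m" "bij_betw (lin bs) (words m) Q"
    using basis_exists[OF Q_0 Q_add Q_mult card_Q] .
  define G where "G x = (\<Sum>v<n. syndrome c (Suc v) * x ^ (n - Suc v)) +
    (\<Sum>v<n. syndrome d (Suc v) * x ^ (n - Suc v))" for x
  have carrier: "c \<in> carrier_vec n" "d \<in> carrier_vec n"
    using c d by (auto simp: cyclic_code_def)
  then have dim: "dim_vec (extend_vec c) = Suc n" "dim_vec (extend_vec d) = Suc n"
    by (auto simp: extend_vec_def)
  have G: "G (pt i) = 0 \<longleftrightarrow> extend_vec c $ i = extend_vec d $ i" if "i < Suc n" for i
    unfolding G_def using that carrier
    by (simp flip: extend_eq_sum_syndromes eq_iff_add_eq_0)
  have "card {w \<in> words m. G (lin bs w) \<noteq> 0} = card {x \<in> Q. G x \<noteq> 0}"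
    by (rule bij_betw_same_card[of "lin bs"])
       (use bs(2) in \<open>auto simp: bij_betw_def inj_on_def\<close>)
  also have "\<dots> = card {i \<in> {..<Suc n}. G (pt i) \<noteq> 0}"
    by (rule bij_betw_same_card[of pt, symmetric])
       (use bij_betw_pt in \<open>auto simp: bij_betw_def inj_on_def\<close>)
  also have "{i \<in> {..<Suc n}. G (pt i) \<noteq> 0} = {i. i < Suc n \<and> extend_vec c $ i \<noteq> extend_vec d $ i}"
    using G by auto
  finally have wt: "wt m (\<lambda>w. G (lin bs w)) = hamming_dist (extend_vec c) (extend_vec d)"
    by (simp add: wt_def hamming_dist_def dim)
  have "bideg m (adm r t) (\<lambda>w. G (lin bs w))"
    unfolding G_def by (intro bideg_add bideg_sum bideg_syndrome[OF c r I bs(1)] bideg_syndrome[OF d r I bs(1)]) auto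
  moreover have "\<exists>w\<in>words m. G (lin bs w) \<noteq> 0"
  proof -
    obtain i where i: "i < Suc n" "extend_vec c $ i \<noteq> extend_vec d $ i"
      using neq dim by (auto simp: vec_eq_iff)
    moreover have "pt i \<in> lin bs ` words m"
      using bs(2) pt_in_Q by (simp add: bij_betw_def)
    ultimately show ?thesis
      using G[OF i(1)] by auto
  qed
  ultimately show ?thesis
    using weight_bound wt by metis
qed

text \<open>The support is a subspace \<open>U\<close> of dimension \<open>2 * m - r + 1\<close>
  over the prime field. The exponents of the zeros have binary weight at most
  \<open>2 * m - r\<close>, less than this dimension, so their power sums over \<open>U\<close>
  vanish.\<close>

lemma codeword_exists:
  assumes "1 \<le> r" "r \<le> 2 * m - 1"
  obtains c where "c \<in> cyclic_code n (zeros r I)" "0\<^sub>v n \<in> cyclic_code n (zeros r I)"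
    "hamming_dist (extend_vec c) (extend_vec (0\<^sub>v n)) = 2 ^ (2 * m - r + 1)"
proof -
  let ?d = "2 * m - r + 1"
  have card: "card Q = 2 ^ (2 * m)" and d: "?d \<le> 2 * m"
    using assms by (simp_all add: card_Q power_mult)
  have "\<exists>U\<subseteq>Q. 0 \<in> U \<and> card U = 2 ^ ?d \<and>
      (\<forall>J. finite J \<and> card J < ?d \<longrightarrow> (\<Sum>x\<in>U. \<Prod>j\<in>J. x ^ (2 ^ j)) = 0)"
    by (rule power_sum_subspace[OF Q_0 _ card d]) (rule Q_add)
  then obtain U where U: "U \<subseteq> Q" "0 \<in> U" "card U = 2 ^ ?d"
    and sums: "\<forall>J. finite J \<and> card J < ?d \<longrightarrow> (\<Sum>x\<in>U. \<Prod>j\<in>J. x ^ (2 ^ j)) = 0"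
    by (elim exE conjE)
  define c :: "bit vec" where "c = vec n (\<lambda>i. of_bool (\<zeta> ^ i \<in> U))"
  have finU: "finite U" using U(3) by (intro card_ge_0_finite) simp
  have bij: "bij_betw pt {i \<in> {..<Suc n}. pt i \<in> U} U"
    using bij_betw_pt U(1) by (auto simp: bij_betw_def inj_on_def image_iff)
  have bij': "bij_betw (\<lambda>i. \<zeta> ^ i) {i \<in> {..<n}. \<zeta> ^ i \<in> U} (U - {0})"
  proof -
    have "bij_betw pt ({i \<in> {..<Suc n}. pt i \<in> U} - {n}) (U - pt ` {n})"
      using bij U(2) by (intro bij_betw_DiffI) (auto simp: pt_def)
    moreover have "{i \<in> {..<Suc n}. pt i \<in> U} - {n} = {i \<in> {..<n}. \<zeta> ^ i \<in> U}"
      by (auto simp: pt_def)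
    ultimately have "bij_betw pt {i \<in> {..<n}. \<zeta> ^ i \<in> U} (U - {0})"
      by (simp add: pt_def[of n])
    then show ?thesis
      by (rule bij_betw_cong[THEN iffD1, rotated]) (simp add: pt_def)
  qed
  have "(\<Sum>i<n. to_ac (c $ i) * (\<zeta> ^ u) ^ i) = 0" if u: "0 < u" "u \<le> n" "int (wt2 m u) \<le> 2 * int m - int r" for u
  proof -
    have "(\<Sum>i<n. to_ac (c $ i) * (\<zeta> ^ u) ^ i) = (\<Sum>i\<in>{i \<in> {..<n}. \<zeta> ^ i \<in> U}. (\<zeta> ^ i) ^ u)"
      by (intro sum.mono_neutral_cong_right) (auto simp: c_def mult.commute simp flip: power_mult)
    also have "\<dots> = (\<Sum>x\<in>U - {0}. x ^ u)"
      using bij' by (rule sum.reindex_bij_betw)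
    \<comment> \<open>As \<open>u > 0\<close>, the point 0 can be put back at no cost.\<close>
    also have "\<dots> = (\<Sum>x\<in>U. x ^ u)"
      using u finU by (intro sum.mono_neutral_left) auto
    also have "\<dots> = (\<Sum>x\<in>U. \<Prod>j\<in>digits m u. x ^ (2 ^ j))"
      using u Suc_n by (intro sum.cong refl power_eq_prod_digits) simp
    also have "\<dots> = 0"
      using u by (intro sums[rule_format] conjI finite_digits) (simp add: wt2_eq_card)
    finally show ?thesis .
  qed
  then have c_code: "c \<in> cyclic_code n (zeros r I)"
    by (auto simp: cyclic_code_def zeros_def Z_pred_def c_def)
  have zero_code: "0\<^sub>v n \<in> cyclic_code n (zeros r I)"
    by (auto simp: cyclic_code_def)
  have ext: "extend_vec c $ i \<noteq> extend_vec (0\<^sub>v n) $ i \<longleftrightarrow> pt i \<in> U" if "i < Suc n" for i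
  proof (cases "i < n")
    case False
    \<comment> \<open>\<open>card U\<close> is even, so an odd number of the first \<open>n\<close>
      coordinates is 1. Hence the parity coordinate is 1, in accordance with
      \<open>0 \<in> U\<close>.\<close>
    have "(\<Sum>j<n. c $ j) = of_nat (card {i \<in> {..<n}. \<zeta> ^ i \<in> U})"
      by (simp add: c_def sum.If_cases of_bool_def Int_def)
    also have "card {i \<in> {..<n}. \<zeta> ^ i \<in> U} = card U - 1"
      using bij_betw_same_card[OF bij'] U(2) by simp
    also have "of_nat (card U - 1) = (1::bit)"
      using U(3) by (simp add: of_nat_diff)
    finally show ?thesis
      using False that U(2) by (simp add: extend_vec_def pt_def c_def)
  qed (simp add: extend_vec_def pt_def c_def)
  have dim: "dim_vec (extend_vec c) = Suc n"
    by (simp add: extend_vec_def c_def)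
  have "{i. i < dim_vec (extend_vec c) \<and> extend_vec c $ i \<noteq> extend_vec (0\<^sub>v n) $ i} =
      {i \<in> {..<Suc n}. pt i \<in> U}"
    using ext dim by auto
  then have "hamming_dist (extend_vec c) (extend_vec (0\<^sub>v n)) = 2 ^ ?d"
    using bij_betw_same_card[OF bij] U(3) by (simp add: hamming_dist_def)
  with c_code zero_code show thesis
    by (rule that)
qed

section \<open>The minimum distance\<close>

lemma min_dist_bounds:
  assumes "1 \<le> r" "r \<le> 2 * m - 1" and I: "\<And>k. k \<in> I \<Longrightarrow> t \<le> int m - k"
  shows "gain t * 2 ^ (2 * m - r) \<le> 2 * min_dist (C_code m \<zeta> r I)"
    and "min_dist (C_code m \<zeta> r I) \<le> 2 ^ (2 * m - r + 1)"
proof -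
  let ?S = "{hamming_dist x y | x y. x \<in> C_code m \<zeta> r I \<and> y \<in> C_code m \<zeta> r I \<and> x \<noteq> y}"
  have C: "C_code m \<zeta> r I = extend_vec ` cyclic_code n (zeros r I)"
    by (simp add: C_code_def extended_code_def zeros_def)
  obtain c where c: "c \<in> cyclic_code n (zeros r I)" "0\<^sub>v n \<in> cyclic_code n (zeros r I)"
    "hamming_dist (extend_vec c) (extend_vec (0\<^sub>v n)) = 2 ^ (2 * m - r + 1)"
    using codeword_exists[OF assms(1,2)] .
  have "extend_vec c \<noteq> extend_vec (0\<^sub>v n)"
    using c(3) by (auto simp: hamming_dist_def)
  then have S: "2 ^ (2 * m - r + 1) \<in> ?S"
    using c by (intro CollectI exI[of _ "extend_vec c"] exI[of _ "extend_vec (0\<^sub>v n)"]) (auto simp: C)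
  then show "min_dist (C_code m \<zeta> r I) \<le> 2 ^ (2 * m - r + 1)"
    unfolding min_dist_def by (rule wellorder_Inf_le1)
  \<comment> \<open>The infimum is attained because \<open>?S\<close> is non-empty;
    \<open>Inf {}\<close> would be 0.\<close>
  have "min_dist (C_code m \<zeta> r I) \<in> ?S"
    unfolding min_dist_def using S by (intro Inf_nat_def1) blast
  then obtain x y where xy: "x \<in> cyclic_code n (zeros r I)" "y \<in> cyclic_code n (zeros r I)"
    "extend_vec x \<noteq> extend_vec y" "min_dist (C_code m \<zeta> r I) = hamming_dist (extend_vec x) (extend_vec y)"
    unfolding C by blast
  have "gain t * 4 ^ m \<le> 2 * 2 ^ r * min_dist (C_code m \<zeta> r I)"
    unfolding xy(4) using xy(1-3) assms by (rule hamming_dist_bound)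
  moreover have "(4::nat) ^ m = 2 ^ r * 2 ^ (2 * m - r)"
    using assms(2) by (simp add: power_mult flip: power_add)
  ultimately have "2 ^ r * (gain t * 2 ^ (2 * m - r)) \<le> 2 ^ r * (2 * min_dist (C_code m \<zeta> r I))"
    by (simp only: mult_ac)
  then show "gain t * 2 ^ (2 * m - r) \<le> 2 * min_dist (C_code m \<zeta> r I)"
    by simp
qed

end

theorem theorem4p9:
  fixes m r :: nat and I :: "int set" and \<zeta> :: "bit alg_closure"
  assumes "m \<ge> 1"
    and "1 \<le> r" and "r \<le> 2 * m - 1"
    and "I \<subseteq> M_set m r"
    and "primitive_root_of_unity (code_length m) \<zeta>"
  shows "({int m, int m - 1, int m - 2} \<inter> I = {} \<longrightarrow>
            min_dist (C_code m \<zeta> r I) = 2 ^ (2 * m - r + 1)) \<and>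
         ({int m, int m - 1} \<inter> I \<noteq> {} \<longrightarrow>
            min_dist (C_code m \<zeta> r I) \<ge> 2 ^ (2 * m - r)) \<and>
         ({int m, int m - 2} \<inter> I = {int m - 2} \<longrightarrow>
            min_dist (C_code m \<zeta> r I) \<ge> 3 * 2 ^ (2 * m - r - 1))"
proof -
  interpret root_of_unity m \<zeta>
    using assms by unfold_locales auto
  note bounds = min_dist_bounds[OF assms(2,3)]
  have le_m: "k \<le> int m" if "k \<in> I" for k
    using that assms(4) by (auto simp: M_set_def split: if_splits)
  show ?thesis
  proof (intro conjI impI)
    assume "{int m, int m - 1, int m - 2} \<inter> I = {}"
    then have "3 \<le> int m - k" if "k \<in> I" for k
      using le_m[OF that] that by (cases "k = int m \<or> k = int m - 1 \<or> k = int m - 2") auto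
    \<comment> \<open>\<open>gain 3 = 4\<close>, so the lower bound meets the weight of the
      indicator codeword.\<close>
    from bounds(1)[of I, OF this] bounds(2)[of I, OF this]
    show "min_dist (C_code m \<zeta> r I) = 2 ^ (2 * m - r + 1)"
      by (simp add: gain_def)
  next
    \<comment> \<open>All \<open>k \<in> I\<close> satisfy \<open>k \<le> m\<close>, which permits
      \<open>t = 0\<close> with \<open>gain 0 = 2\<close>.\<close>
    show "2 ^ (2 * m - r) \<le> min_dist (C_code m \<zeta> r I)"
      using bounds(1)[of I 0] le_m by (simp add: gain_def)
  next
    assume "{int m, int m - 2} \<inter> I = {int m - 2}"
    then have "int m - 2 \<in> I" "int m \<in> I \<Longrightarrow> int m \<in> {int m - 2}"
      by blast+
    then have "int m - 2 \<in> I" "int m \<notin> I"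
      by auto
    then have "2 \<le> int m - k" if "k \<in> I" for k
    proof -
      \<comment> \<open>On \<open>M_set m r\<close> the parity of \<open>m - k\<close> is constant;
        \<open>m - 2 \<in> I\<close> makes it even, which excludes \<open>m - 1\<close>.\<close>
      have "even (int m - k)"
        using that \<open>int m - 2 \<in> I\<close> assms(4) by (auto simp: M_set_def split: if_splits)
      moreover have "k \<noteq> int m"
        using that \<open>int m \<notin> I\<close> by auto
      ultimately show ?thesis
        using le_m[OF that] by presburger
    qed
    from bounds(1)[of I, OF this]
    have "3 * 2 ^ (2 * m - r) \<le> 2 * min_dist (C_code m \<zeta> r I)"
      by (simp add: gain_def)
    \<comment> \<open>The exponent is positive, so a factor 2 can be split off and
      cancelled.\<close>
    moreover have "2 * m - r = Suc (2 * m - r - 1)"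
      using assms(1,3) by simp
    then have "(2::nat) ^ (2 * m - r) = 2 * 2 ^ (2 * m - r - 1)"
      by (metis power_Suc)
    ultimately show "3 * 2 ^ (2 * m - r - 1) \<le> min_dist (C_code m \<zeta> r I)"
      by linarith
  qed
qed

end
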